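(* Let $n,N\in\mathbb{N}$ with $n,N\ge 1$, let $\xi_1,\dots,\xi_N\in[-1,1]$ and $\lambda_1,\dots,\lambda_N\ge 0$, and put $\mathcal{T}(f):=\sum_{i=1}^N\lambda_if(\xi_i)$ for $f:[-1,1]\to\mathbb{R}$. (i) If $\mathcal{T}$ is exact on $\Pi_{2n-1}$, then $\mathcal{G}_n(f)\le\mathcal{T}(f)\le\mathcal{L}_{n+1}(f)$ for any $(2n-1)$-convex function $f:[-1,1]\to\mathbb{R}$. (ii) If $\mathcal{T}$ is exact on $\Pi_{2n}$, then $\mathcal{R}^l_{n+1}(f)\le\mathcal{T}(f)\le\mathcal{R}^r_{n+1}(f)$ for any $2n$-convex function $f:[-1,1]\to\mathbb{R}$.
   Context: Divided differences: $[x_1;f]:=f(x_1)$ and $[x_1,\dots,x_{k+1};f]:=\frac{[x_2,\dots,x_{k+1};f]-[x_1,\dots,x_k;f]}{x_{k+1}-x_1}$ for $k\ge 1$. For an integer $m\ge 1$, a function $f:I\to\mathbb{R}$ on an interval $I$ is $m$-convex if $[x_1,\dots,x_{m+2};f]\ge 0$ for all distinct $x_1,\dots,x_{m+2}\in I$ (so $1$-convexity is ordinary convexity; no differentiability or continuity is assumed). $\Pi_m$ is the space of real polynomials of degree at most $m$. $\mathcal{I}(f):=\int_{-1}^1 f(x)\,dx$. $\mathcal{T}$ is exact on $\Pi_m$ if $\mathcal{T}(p)=\mathcal{I}(p)$ for all $p\in\Pi_m$. $P_m$ is the Legendre polynomial of degree $m$ (standard normalization $P_m(1)=1$). For $f:[-1,1]\to\mathbb{R}$: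 Gauss–Legendre: for $m\ge 1$, $\mathcal{G}_m(f):=\sum_{i=1}^m w_i f(x_i)$, where $x_1,\dots,x_m$ are the roots of $P_m$ and $w_i=\frac{2(1-x_i^2)}{(m+1)^2P_{m+1}^2(x_i)}$. Lobatto: $\mathcal{L}_2(f):=f(-1)+f(1)$, and for $m\ge 3$, $\mathcal{L}_m(f):=w_1f(-1)+w_mf(1)+\sum_{i=2}^{m-1}w_if(x_i)$, where $x_2,\dots,x_{m-1}$ are the roots of $P_{m-1}'$, $w_1=w_m=\frac{2}{m(m-1)}$ and $w_i=\frac{2}{m(m-1)P_{m-1}^2(x_i)}$ for $2\le i\le m-1$. Radau: for $m\ge 2$, $\mathcal{R}^l_m(f):=w_1f(-1)+\sum_{i=2}^m w_if(x_i)$, where $x_2,\dots,x_m$ are the roots of the polynomial $Q_{m-1}(x)=\frac{P_{m-1}(x)+P_m(x)}{x+1}$, $w_1=\frac{2}{m^2}$ and $w_i=\frac{1}{(1-x_i)[P_{m-1}'(x_i)]^2}$ for $2\le i\le m$. Further, $\mathcal{R}^r_m(f):=\mathcal{R}^l_m(\tilde f)$ where $\tilde f(x)=f(-x)$. *)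

theory Defs
  imports "HOL-Analysis.Analysis" "HOL-Computational_Algebra.Polynomial"
begin

text \<open>
  Divided differences \<open>[x\<^sub>1, \<dots>, x\<^sub>k; f]\<close>, with the list of nodes as first argument.
  The equation for the empty list only makes the function total.
\<close>

fun divdiff :: "real list \<Rightarrow> (real \<Rightarrow> real) \<Rightarrow> real" where
  "divdiff [] f = 0"
| "divdiff [x] f = f x"
| "divdiff (x # y # xs) f =
     (divdiff (y # xs) f - divdiff (butlast (x # y # xs)) f) / (last (y # xs) - x)"

definition m_convex_on :: "nat \<Rightarrow> real set \<Rightarrow> (real \<Rightarrow> real) \<Rightarrow> bool" where
  "m_convex_on m I f \<longleftrightarrow>
     (\<forall>xs. length xs = m + 2 \<and> distinct xs \<and> set xs \<subseteq> I \<longrightarrow> divdiff xs f \<ge> 0)"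

definition exact_on_Pi :: "((real \<Rightarrow> real) \<Rightarrow> real) \<Rightarrow> nat \<Rightarrow> bool" where
  "exact_on_Pi T m \<longleftrightarrow>
     (\<forall>p :: real poly. degree p \<le> m \<longrightarrow> T (poly p) = integral {-1..1} (poly p))"

definition quad :: "nat \<Rightarrow> (nat \<Rightarrow> real) \<Rightarrow> (nat \<Rightarrow> real) \<Rightarrow> (real \<Rightarrow> real) \<Rightarrow> real" where
  "quad N w \<xi> f = (\<Sum>i=1..N. w i * f (\<xi> i))"

text \<open>
  Rodrigues' formula \<open>P\<^sub>m(x) = 1 / (2\<^sup>m m!) (d/dx)\<^sup>m (x\<^sup>2 - 1)\<^sup>m\<close>,
  which has the normalization \<open>P\<^sub>m(1) = 1\<close>.
\<close>

definition legendre :: "nat \<Rightarrow> real poly" where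
  "legendre m = smult (1 / (2 ^ m * fact m)) ((pderiv ^^ m) ([:-1, 0, 1:] ^ m))"

text \<open>
  All roots of the node polynomials below are real and simple, so each list of nodes is
  rendered as the set of real roots, and each weight \<open>w\<^sub>i\<close> as a function of the node \<open>x\<^sub>i\<close>.
\<close>

definition gauss :: "nat \<Rightarrow> (real \<Rightarrow> real) \<Rightarrow> real" where
  "gauss m f =
     (\<Sum>x | poly (legendre m) x = 0.
        2 * (1 - x\<^sup>2) / ((real m + 1)\<^sup>2 * (poly (legendre (m + 1)) x)\<^sup>2) * f x)"

text \<open>The Lobatto and Radau rules are meant for \<open>m \<ge> 2\<close> only.\<close>

definition lobatto :: "nat \<Rightarrow> (real \<Rightarrow> real) \<Rightarrow> real" where
  "lobatto m f =
     (if m = 2 then f (-1) + f 1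
      else 2 / (real m * (real m - 1)) * f (-1) + 2 / (real m * (real m - 1)) * f 1 +
        (\<Sum>x | poly (pderiv (legendre (m - 1))) x = 0.
           2 / (real m * (real m - 1) * (poly (legendre (m - 1)) x)\<^sup>2) * f x))"

text \<open>\<open>radau_poly m\<close> is \<open>Q\<^bsub>m-1\<^esub>\<close>; the division by \<open>x + 1\<close> is exact since \<open>P\<^sub>k(-1) = (-1)\<^sup>k\<close>.\<close>

definition radau_poly :: "nat \<Rightarrow> real poly" where
  "radau_poly m = (legendre (m - 1) + legendre m) div [:1, 1:]"

definition radau_l :: "nat \<Rightarrow> (real \<Rightarrow> real) \<Rightarrow> real" where
  "radau_l m f =
     2 / (real m)\<^sup>2 * f (-1) +
     (\<Sum>x | poly (radau_poly m) x = 0.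
        1 / ((1 - x) * (poly (pderiv (legendre (m - 1))) x)\<^sup>2) * f x)"

definition radau_r :: "nat \<Rightarrow> (real \<Rightarrow> real) \<Rightarrow> real" where
  "radau_r m f = radau_l m (\<lambda>x. f (- x))"

end

theory Submission
  imports Defs
begin

text \<open>
  Each of the four classical rules is exact on \<open>\<Pi>\<^sub>m\<close> with \<open>m = 2 * n - 1\<close> or
  \<open>m = 2 * n\<close>, and \<open>m + 1\<close> is the number of its nodes when the interior ones are counted twice.
  For smooth \<open>f\<close> one would compare \<open>f\<close> with its Hermite interpolant at these nodes: the
  error is a divided difference of order \<open>m + 1\<close>, which is not negative by \<open>m\<close>-convexity, times
  a node polynomial in which the interior nodes contribute squares. Its sign is thus decided by
  the endpoint nodes, namely 1 for Gauss, \<open>x\<^sup>2 - 1\<close> for Lobatto, \<open>x + 1\<close> and \<open>x - 1\<close>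
  for the two Radau rules. Applying \<open>\<T>\<close> to the interpolant, where both rules are exact, gives
  the inequality.

  Since \<open>f\<close> need not be differentiable, a double node \<open>r\<close> is replaced by the pair
  \<open>r\<close>, \<open>r + h\<close>. The node polynomial then has the wrong sign only strictly between such pairs,
  and if \<open>h\<close> is small enough, no node of \<open>\<T>\<close> is there. One such \<open>h\<close> suffices for the whole
  argument (\<open>quadrature_comparison\<close>).

  It remains to prove that the four rules with their explicit weights are exact, and that
  each node polynomial has as many distinct roots inside the interval as its degree allows. The
  right Radau rule is the mirror image of the left one; the others are treated uniformly, with
  nodes at the roots of \<open>\<omega> * Q\<close>, where \<open>\<omega>\<close> is one of \<open>1\<close>, \<open>1 - x\<^sup>2\<close>, \<open>1 + x\<close> and
  \<open>Q\<close> is orthogonal with weight \<open>\<omega>\<close> to all polynomials of smaller degree (locale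
  \<open>gauss_type\<close>). Orthogonality gives the location of the roots and the existence of weights;
  \<open>weight_identity\<close> computes the weights by one integration by parts. The Legendre polynomials
  enter through two relations derived from Rodrigues' formula, \<open>pderiv_legendre_Suc\<close> and
  \<open>U_times_pderiv_legendre_eq_Suc\<close>.
\<close>

section \<open>Integration of polynomials over the interval from -1 to 1\<close>

definition poly_integral :: "real poly \<Rightarrow> real" where
  "poly_integral p = integral {-1..1} (poly p)"

lemma integrable_poly: "poly p integrable_on {a..b::real}"
  by (intro integrable_continuous_real continuous_intros)

lemma poly_integral_add: "poly_integral (p + q) = poly_integral p + poly_integral q"
  by (simp add: poly_integral_def poly_add [abs_def] integral_add integrable_poly)

lemma poly_integral_smult: "poly_integral (smult c p) = c * poly_integral p"
  by (simp add: poly_integral_def poly_smult [abs_def])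

lemma poly_integral_0 [simp]: "poly_integral 0 = 0"
  using poly_integral_smult[of 0 0] by simp

lemma poly_integral_diff: "poly_integral (p - q) = poly_integral p - poly_integral q"
  using poly_integral_add[of "p - q" q] by simp

lemma poly_integral_sum: "poly_integral (\<Sum>x\<in>A. p x) = (\<Sum>x\<in>A. poly_integral (p x))"
  by (induction A rule: infinite_finite_induct) (auto simp: poly_integral_add)

lemma poly_integral_pderiv: "poly_integral (pderiv p) = poly p 1 - poly p (-1)"
proof -
  have "(poly (pderiv p) has_integral (poly p 1 - poly p (-1))) {-1..1}"
    by (intro fundamental_theorem_of_calculus)
       (auto simp flip: has_real_derivative_iff_has_vector_derivative
             intro!: DERIV_subset[OF poly_DERIV])
  then show ?thesis
    unfolding poly_integral_def by (rule integral_unique)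
qed

lemma poly_integral_pcompose_uminus: "poly_integral (pcompose p [:0, -1:]) = poly_integral p"
proof -
  have "integral {-1..1} (\<lambda>x. poly p (- x)) = integral {-1..1} (poly p)"
    using Henstock_Kurzweil_Integration.integral_reflect_real[where a = "-1" and b = 1 and f = "poly p"] by simp
  then show ?thesis
    by (simp add: poly_integral_def poly_pcompose [abs_def])
qed

text \<open>
  Used to show that a polynomial orthogonal to enough others must change sign.
\<close>

lemma poly_integral_nonneg_eq_0:
  assumes "poly_integral p = 0" "\<And>x. x \<in> {-1<..<1} \<Longrightarrow> poly p x \<ge> 0"
  shows "p = 0"
proof (rule ccontr)
  assume "p \<noteq> 0"
  have "closure {-1<..<1::real} \<subseteq> {x. poly p x \<ge> 0}"
    by (rule closure_minimal) (auto simp: assms(2) intro!: closed_Collect_le continuous_intros)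
  then have nonneg: "poly p x \<ge> 0" if "x \<in> {-1..1}" for x
    using that by auto
  have "poly p x = 0" if "x \<in> {-1..1}" for x
  proof -
    have "(poly p has_integral 0) (cbox (-1) 1)"
      using assms(1) integrable_poly[of p "-1" 1]
      by (simp add: poly_integral_def has_integral_integral)
    then show ?thesis
      using has_integral_0_cbox_imp_0[of "-1" 1 "poly p" x] nonneg that
        continuous_on_poly[OF continuous_on_id, of "{-1..1}" p]
      by auto
  qed
  then have "{-1..1::real} \<subseteq> {x. poly p x = 0}" by blast
  then have "finite {-1..1::real}"
    using poly_roots_finite[OF \<open>p \<noteq> 0\<close>] finite_subset by blast
  then show False
    using infinite_Icc[of "-1" "1::real"] by simp
qed

section \<open>Divided differences\<close>

lemma divdiff_Cons:
  assumes "xs \<noteq> []"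
  shows "divdiff (x # xs) f = (divdiff xs f - divdiff (butlast (x # xs)) f) / (last xs - x)"
  using assms by (cases xs) auto

lemma divdiff_diff: "divdiff xs (\<lambda>x. f x - g x) = divdiff xs f - divdiff xs g"
proof (induction xs rule: length_induct)
  case (1 xs)
  show ?case
  proof (cases xs)
    case (Cons x ys)
    show ?thesis
    proof (cases ys)
      case (Cons y zs)
      have "divdiff ys (\<lambda>x. f x - g x) = divdiff ys f - divdiff ys g"
        "divdiff (butlast xs) (\<lambda>x. f x - g x) = divdiff (butlast xs) f - divdiff (butlast xs) g"
        using 1 Cons \<open>xs = x # ys\<close> by simp_all
      then show ?thesis
        using Cons \<open>xs = x # ys\<close> by (simp add: diff_divide_distrib)
    qed (use Cons in simp)
  qed simp
qed

text \<open>
  The Leibniz rule for a product with the identity function. It has an equivalent form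
  with the last node in place of the first one and \<open>butlast\<close> in place of \<open>tl\<close>; the
  two forms differ by the recursion for divided differences itself. The induction step uses the
  form with the last node on \<open>tl xs\<close> and the form with the first node on \<open>butlast xs\<close>,
  which are exactly the two lists in the recursion.
\<close>

lemma divdiff_times_id:
  assumes "distinct xs" "length xs \<ge> 2"
  shows "divdiff xs (\<lambda>x. x * g x) = hd xs * divdiff xs g + divdiff (tl xs) g"
  using assms
proof (induction xs rule: length_induct)
  case (1 xs)
  obtain a ys where xs: "xs = a # ys" and ys: "ys \<noteq> []"
    using 1(3) by (cases xs; cases "tl xs") auto
  define b where "b = last ys"
  have ab: "a \<noteq> b"
    using 1(2) xs ys by (auto simp: b_def)
  have quot: "divdiff xs h * (b - a) = divdiff ys h - divdiff (butlast xs) h" for h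
    using ab ys by (simp add: xs divdiff_Cons b_def)
  show ?case
  proof (cases "length ys = 1")
    case True
    then obtain y where "ys = [y]" by (cases ys) auto
    then show ?thesis using ab by (simp add: xs b_def field_simps)
  next
    case False
    with ys have len: "length ys \<ge> 2" by (cases ys) (auto simp: Suc_le_eq)
    have IH1: "divdiff ys (\<lambda>x. x * g x) = hd ys * divdiff ys g + divdiff (tl ys) g"
      using 1 xs len by simp
    have IH2: "divdiff (butlast xs) (\<lambda>x. x * g x) =
        a * divdiff (butlast xs) g + divdiff (butlast ys) g"
    proof -
      have "distinct (butlast xs)" using 1(2) by (rule distinct_butlast)
      moreover have "length (butlast xs) \<ge> 2" "length (butlast xs) < length xs"
        using len xs ys by simp_all
      ultimately show ?thesis using 1(1) xs ys by fastforce
    qed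
    obtain y zs where yzs: "ys = y # zs" and zs: "zs \<noteq> []"
      using len by (cases ys; cases "tl ys") auto
    have "b \<noteq> y"
      using 1(2) xs yzs zs by (auto simp: b_def)
    then have "divdiff ys g * (b - y) = divdiff zs g - divdiff (butlast ys) g"
      using zs by (simp add: yzs divdiff_Cons b_def)
    with IH1 have IH1': "divdiff ys (\<lambda>x. x * g x) = b * divdiff ys g + divdiff (butlast ys) g"
      by (simp add: yzs algebra_simps)
    have "divdiff xs (\<lambda>x. x * g x) * (b - a) = (a * divdiff xs g + divdiff ys g) * (b - a)"
      using quot[of "\<lambda>x. x * g x"] quot[of g] IH1' IH2 by algebra
    then show ?thesis using ab xs by simp
  qed
qed

text \<open>
  By Horner's scheme \<open>pCons c p\<close> is \<open>c + x * p\<close>, and the Leibniz rule trades the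
  factor \<open>x\<close> for the loss of one node, so degree and number of nodes drop together.
\<close>

lemma divdiff_poly_eq_0:
  assumes "distinct xs" "length xs > degree p + 1"
  shows "divdiff xs (poly p) = 0"
  using assms
proof (induction p arbitrary: xs rule: pCons_induct)
  case 0
  have "divdiff xs (\<lambda>x. (0::real) - 0) = 0"
    by (subst divdiff_diff) simp
  then show ?case by (simp add: poly_0 [abs_def])
next
  case (pCons c p)
  have const: "divdiff xs (\<lambda>x. c) = (if length xs = 1 then c else 0)" for c :: real and xs
  proof (induction xs rule: length_induct)
    case (1 xs)
    show ?case
    proof (cases "length xs \<le> 1")
      case True
      then show ?thesis by (cases xs) auto
    next
      case False
      then obtain x y zs where "xs = x # y # zs"
        by (cases xs rule: divdiff.cases[of "(xs, undefined)" for xs]) (auto elim: list.exhaust)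
      then show ?thesis using 1 by (auto simp: divdiff_Cons)
    qed
  qed
  show ?case
  proof (cases "p = 0")
    case True
    have "poly [:c:] = (\<lambda>x. c)" by (simp add: fun_eq_iff)
    then show ?thesis using True pCons.prems by (simp add: const)
  next
    case False
    then have len: "length xs > degree p + 2" using pCons.prems by simp
    have "divdiff xs (poly (pCons c p)) = divdiff xs (\<lambda>x. x * poly p x - (- c))"
      by (rule arg_cong[of _ _ "divdiff xs"]) (simp add: fun_eq_iff)
    also have "\<dots> = hd xs * divdiff xs (poly p) + divdiff (tl xs) (poly p)"
      unfolding divdiff_diff using pCons.prems len by (simp add: divdiff_times_id const)
    also have "\<dots> = 0"
      using pCons.prems len by (simp add: pCons.IH distinct_tl)
    finally show ?thesis .
  qed
qed

lemma divdiff_eq_0_of_roots: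
  assumes "\<And>z. z \<in> set zs \<Longrightarrow> g z = 0"
  shows "divdiff zs g = 0"
  using assms
proof (induction zs "g" rule: divdiff.induct)
  case (3 x y xs f)
  have "divdiff (y # xs) f = 0" using 3 by simp
  moreover have "divdiff (butlast (x # y # xs)) f = 0"
    using 3(2)[OF 3(3)] in_set_butlastD by fastforce
  ultimately show ?case by simp
qed simp_all

text \<open>
  In the recursion, the divided difference without the last node sees only zeros of \<open>g\<close>
  and vanishes. So every step removes the first node \<open>z\<close> at the price of a factor \<open>x - z\<close>.
\<close>

lemma divdiff_snoc_of_roots:
  assumes "distinct (zs @ [x])" "\<And>z. z \<in> set zs \<Longrightarrow> g z = 0"
  shows "divdiff (zs @ [x]) g * (\<Prod>z\<in>set zs. x - z) = g x"
  using assms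
proof (induction zs)
  case (Cons z zs)
  have "divdiff (z # zs) g = 0"
    by (rule divdiff_eq_0_of_roots) (rule Cons.prems)
  then have "divdiff ((z # zs) @ [x]) g = divdiff (zs @ [x]) g / (x - z)"
    by (simp add: divdiff_Cons butlast_append)
  moreover have "x \<noteq> z" using Cons.prems by auto
  moreover have "divdiff (zs @ [x]) g * (\<Prod>z\<in>set zs. x - z) = g x"
    using Cons.prems by (intro Cons.IH) simp_all
  moreover have "(\<Prod>z\<in>set (z # zs). x - z) = (x - z) * (\<Prod>z\<in>set zs. x - z)"
    using Cons.prems by simp
  ultimately show ?case by simp
qed simp

text \<open>
  Newton's construction: a new node is met by adding a multiple of the node polynomial of the
  old ones.
\<close>

lemma exists_interpolating_poly:
  assumes "finite (S :: real set)"
  shows "\<exists>p. degree p \<le> card S - 1 \<and> (\<forall>s\<in>S. poly p s = f s)"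
  using assms
proof (induction S)
  case empty
  show ?case by (rule exI[of _ 0]) simp
next
  case (insert s S)
  then obtain p where p: "degree p \<le> card S - 1" "\<forall>s\<in>S. poly p s = f s" by blast
  define r where "r = (\<Prod>t\<in>S. [:- t, 1:])"
  have r: "poly r s \<noteq> 0" "degree r = card S" "\<And>t. t \<in> S \<Longrightarrow> poly r t = 0"
    using insert by (auto simp: r_def poly_prod degree_prod_eq_sum_degree)
  define q where "q = p + smult ((f s - poly p s) / poly r s) r"
  have "degree q \<le> card S"
    unfolding q_def using p r by (intro degree_add_le) (auto intro: order.trans[OF degree_smult_le])
  moreover have "\<forall>t\<in>insert s S. poly q t = f t"
    using p r by (auto simp: q_def)
  ultimately show ?case using insert by auto
qed

text \<open>
  The error of polynomial interpolation at \<open>Z\<close> is the divided difference at \<open>Z\<close> and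
  \<open>x\<close> times the node polynomial; \<open>m\<close>-convexity says that this divided difference is not
  negative. Hence the sign of the error is the sign of the node polynomial.
\<close>

lemma convex_minus_interpolant:
  assumes "m_convex_on m I f" "finite Z" "Z \<subseteq> I" "card Z = m + 1" "x \<in> I"
    and "degree p \<le> m" "\<And>z. z \<in> Z \<Longrightarrow> poly p z = f z"
  obtains c where "c \<ge> 0" "f x - poly p x = c * (\<Prod>z\<in>Z. x - z)"
proof (cases "x \<in> Z")
  case True
  then have "f x - poly p x = 0 * (\<Prod>z\<in>Z. x - z)" using assms by simp
  then show ?thesis using that by blast
next
  case False
  obtain zs where zs: "set zs = Z" "distinct zs"
    using finite_distinct_list assms(2) by blast
  then have len: "length zs = m + 1" using distinct_card assms(4) by fastforce
  let ?xs = "zs @ [x]"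
  have dist: "distinct ?xs" using zs False by simp
  have "divdiff ?xs f \<ge> 0"
    using assms zs dist len unfolding m_convex_on_def by auto
  moreover have "divdiff ?xs (poly p) = 0"
    using dist len assms(6) by (intro divdiff_poly_eq_0) auto
  moreover have "divdiff ?xs (\<lambda>x. f x - poly p x) * (\<Prod>z\<in>Z. x - z) = f x - poly p x"
    using divdiff_snoc_of_roots[OF dist, of "\<lambda>x. f x - poly p x"] zs assms(7) by simp
  ultimately show ?thesis using that by (simp add: divdiff_diff)
qed

section \<open>Comparison of positive quadrature rules\<close>

text \<open>
  The rule with endpoint nodes \<open>E\<close> and interior nodes \<open>R\<close> is compared with an arbitrary
  positive rule of the same exactness. The hypothesis on cardinalities says that counting the
  interior nodes twice gives as many conditions as a polynomial of degree \<open>m\<close> has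
  coefficients. Instead of a Hermite interpolant with double nodes, for which \<open>f\<close> would have to be
  differentiable, take the Lagrange interpolant \<open>p\<close> at \<open>r\<close> and \<open>r + h\<close> for \<open>r \<in> R\<close>.
  The factor \<open>(x - r) * (x - (r + h))\<close> of the node polynomial is negative only strictly between
  \<open>r\<close> and \<open>r + h\<close>, and for small \<open>h\<close> none of the finitely many points \<open>\<xi> i\<close>
  is there. So the sign of \<open>f - p\<close> at every \<open>\<xi> i\<close> is that of the factors from \<open>E\<close>,
  and integrating \<open>p\<close> exactly by both rules gives the inequality already for one such
  \<open>h\<close>. The factor \<open>\<sigma>\<close> is 1 for lower and -1 for upper bounds.
\<close>

lemma quadrature_comparison:
  assumes R: "finite R" "R \<subseteq> {-1<..<1}" and E: "E \<subseteq> {-1, 1}"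
    and card: "card E + 2 * card R = m + 1"
    and rule: "\<And>p. degree p \<le> m \<Longrightarrow>
      poly_integral p = (\<Sum>x\<in>E. V x * poly p x) + (\<Sum>x\<in>R. W x * poly p x)"
    and T: "exact_on_Pi (quad N w \<xi>) m"
    and \<xi>: "\<And>i. i \<in> {1..N} \<Longrightarrow> \<xi> i \<in> {-1..1}" and w: "\<And>i. i \<in> {1..N} \<Longrightarrow> w i \<ge> 0"
    and f: "m_convex_on m {-1..1} f"
    and sign: "\<And>x. x \<in> {-1..1} \<Longrightarrow> 0 \<le> \<sigma> * (\<Prod>e\<in>E. x - e)"
  shows "\<sigma> * ((\<Sum>x\<in>E. V x * f x) + (\<Sum>x\<in>R. W x * f x)) \<le> \<sigma> * quad N w \<xi> f"
proof -
  \<comment> \<open>Avoiding \<open>R\<close> and 1 as well keeps the shifted nodes distinct from the others and interior.\<close>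
  define A where "A = insert 1 (R \<union> \<xi> ` {1..N})"
  have "finite A" using R by (simp add: A_def)
  have "\<forall>\<^sub>F h in at_right 0. \<forall>r\<in>R. \<forall>a\<in>A. r < a \<longrightarrow> r + h < a"
  proof (intro eventually_ball_finite \<open>finite R\<close> \<open>finite A\<close> ballI)
    fix r a :: real
    show "\<forall>\<^sub>F h in at_right 0. r < a \<longrightarrow> r + h < a"
    proof (cases "r < a")
      case True
      then have "\<forall>\<^sub>F h in at_right 0. h < a - r"
        by (intro order_tendstoD[OF tendsto_ident_at]) simp
      then show ?thesis by eventually_elim simp
    qed simp
  qed
  moreover have "\<forall>\<^sub>F h in at_right (0::real). h > 0" by (rule eventually_at_right_less)
  ultimately have "\<forall>\<^sub>F h in at_right (0::real). h > 0 \<and> (\<forall>r\<in>R. \<forall>a\<in>A. r < a \<longrightarrow> r + h < a)"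
    by eventually_elim simp
  then obtain h where h: "h > 0" "\<And>r a. r \<in> R \<Longrightarrow> a \<in> A \<Longrightarrow> r < a \<Longrightarrow> r + h < a"
    using eventually_happens'[OF trivial_limit_at_right_real] by blast
  define Rh where "Rh = (\<lambda>r. r + h) ` R"
  have "finite E" using E finite_subset by blast
  have "finite Rh" "card Rh = card R"
    using R by (simp_all add: Rh_def card_image)
  moreover have "r + h \<notin> R" if "r \<in> R" for r
    using h(2)[OF that, of "r + h"] h(1) by (auto simp: A_def)
  then have "Rh \<inter> R = {}" by (auto simp: Rh_def)
  moreover have "- 1 < r + h \<and> r + h < 1" if "r \<in> R" for r
    using h(2)[OF that, of 1] h(1) that R(2) by (auto simp: A_def)
  then have "Rh \<subseteq> {-1<..<1}" by (auto simp: Rh_def)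
  ultimately have Rh: "finite Rh" "card Rh = card R" "Rh \<inter> R = {}" "Rh \<subseteq> {-1<..<1}" by blast+
  have outside: "e \<notin> E" if "e \<in> {-1<..<1}" for e :: real
    using that E by auto
  have ER: "E \<inter> R = {}" "E \<inter> Rh = {}" using outside R Rh by blast+
  define Z where "Z = E \<union> (R \<union> Rh)"
  have Z: "finite Z" "Z \<subseteq> {-1..1}"
  proof -
    have "E \<subseteq> {-1..1}" "{-1<..<1} \<subseteq> {-1..(1::real)}" using E by auto
    then show "finite Z" "Z \<subseteq> {-1..1}"
      using R Rh \<open>finite E\<close> unfolding Z_def by blast+
  qed
  have "card Z = card E + (card R + card Rh)"
    unfolding Z_def using ER R Rh \<open>finite E\<close> by (simp add: card_Un_disjoint Int_Un_distrib Int_commute)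
  then have "card Z = m + 1" using card Rh by simp
  obtain p where p: "degree p \<le> m" "\<And>z. z \<in> Z \<Longrightarrow> poly p z = f z"
    using exists_interpolating_poly[OF Z(1), of f] \<open>card Z = m + 1\<close> by auto
  have below: "\<sigma> * poly p (\<xi> i) \<le> \<sigma> * f (\<xi> i)" if i: "i \<in> {1..N}" for i
  proof -
    obtain c where c: "c \<ge> 0" "f (\<xi> i) - poly p (\<xi> i) = c * (\<Prod>z\<in>Z. \<xi> i - z)"
      using convex_minus_interpolant[OF f Z \<open>card Z = m + 1\<close> \<xi>[OF i] p] by blast
    have "(\<Prod>z\<in>Z. \<xi> i - z) = (\<Prod>e\<in>E. \<xi> i - e) * ((\<Prod>r\<in>R. \<xi> i - r) * (\<Prod>r\<in>Rh. \<xi> i - r))"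
      unfolding Z_def using ER R Rh \<open>finite E\<close> by (simp add: prod.union_disjoint Int_Un_distrib Int_commute)
    also have "(\<Prod>r\<in>Rh. \<xi> i - r) = (\<Prod>r\<in>R. \<xi> i - (r + h))"
      unfolding Rh_def by (subst prod.reindex) auto
    also have "(\<Prod>r\<in>R. \<xi> i - r) * (\<Prod>r\<in>R. \<xi> i - (r + h)) = (\<Prod>r\<in>R. (\<xi> i - r) * (\<xi> i - (r + h)))"
      by (rule prod.distrib [symmetric])
    finally have eq: "(\<Prod>z\<in>Z. \<xi> i - z) =
        (\<Prod>e\<in>E. \<xi> i - e) * (\<Prod>r\<in>R. (\<xi> i - r) * (\<xi> i - (r + h)))" .
    have "(\<Prod>r\<in>R. (\<xi> i - r) * (\<xi> i - (r + h))) \<ge> 0"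
    proof (intro prod_nonneg ballI)
      fix r assume "r \<in> R"
      then have "\<xi> i \<le> r \<or> r + h < \<xi> i"
        using h(2)[of r "\<xi> i"] i by (cases "r < \<xi> i") (auto simp: A_def)
      then show "0 \<le> (\<xi> i - r) * (\<xi> i - (r + h))"
        using h(1) by (auto intro: mult_nonneg_nonneg mult_nonpos_nonpos)
    qed
    then have "0 \<le> c * ((\<sigma> * (\<Prod>e\<in>E. \<xi> i - e)) * (\<Prod>r\<in>R. (\<xi> i - r) * (\<xi> i - (r + h))))"
      by (intro mult_nonneg_nonneg[OF c(1) mult_nonneg_nonneg[OF sign[OF \<xi>[OF i]]]])
    also have "\<dots> = \<sigma> * (f (\<xi> i) - poly p (\<xi> i))"
      by (simp add: c(2) eq)
    finally show ?thesis by (simp add: algebra_simps)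
  qed
  \<comment> \<open>The nodes of the rule are interpolation nodes, so it cannot tell \<open>f\<close> from \<open>p\<close>.\<close>
  have "(\<Sum>x\<in>E. V x * f x) + (\<Sum>x\<in>R. W x * f x) = poly_integral p"
    unfolding rule[OF p(1)]
    by (intro arg_cong2[of _ _ _ _ "(+)"] sum.cong refl) (auto simp: p(2) Z_def)
  also have "\<dots> = quad N w \<xi> (poly p)"
    using T p(1) by (simp add: exact_on_Pi_def poly_integral_def)
  also have "\<sigma> * \<dots> \<le> \<sigma> * quad N w \<xi> f"
    unfolding quad_def sum_distrib_left
  proof (rule sum_mono)
    fix i assume i: "i \<in> {1..N}"
    show "\<sigma> * (w i * poly p (\<xi> i)) \<le> \<sigma> * (w i * f (\<xi> i))"
      using mult_left_mono[OF below[OF i] w[OF i]] by (simp add: ac_simps)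
  qed
  finally show ?thesis by simp
qed

section \<open>Legendre polynomials\<close>

text \<open>
  Rodrigues' formula is exploited by the Leibniz rule. The Leibniz rule is needed only for
  multiplication by \<open>X\<close>, since \<open>U\<close> is \<open>X * X - 1\<close>; integer factors are written with
  \<open>of_nat\<close>, so that all identities can be checked in the language of commutative rings.
\<close>

abbreviation X :: "real poly" where "X \<equiv> [:0, 1:]"

abbreviation U :: "real poly" where "U \<equiv> [:-1, 0, 1:]"

lemma U_eq: "U = X * X - 1"
  by (simp add: one_pCons)

lemma of_nat_mult_conv_smult: "of_nat n * p = smult (of_nat n) p" for p :: "'a::comm_semiring_1 poly"
  by (simp add: of_nat_poly)

lemma pderiv_of_nat_mult: "pderiv (of_nat n * p) = of_nat n * pderiv p"
  by (simp add: pderiv_mult)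

lemma higher_pderiv_of_nat_mult: "(pderiv ^^ k) (of_nat n * p) = of_nat n * (pderiv ^^ k) p"
  by (induction k) (simp_all add: pderiv_of_nat_mult)

lemma pderiv_X_mult: "pderiv (X * p) = p + X * pderiv p"
  by (simp only: pderiv_mult) (simp add: pderiv_pCons)

lemma higher_pderiv_X_mult:
  "(pderiv ^^ Suc k) (X * p) = X * (pderiv ^^ Suc k) p + of_nat (Suc k) * (pderiv ^^ k) p"
proof (induction k)
  case 0
  show ?case
    by (simp only: funpow.simps o_def id_apply pderiv_X_mult of_nat_Suc of_nat_0) algebra
next
  case (Suc k)
  have "(pderiv ^^ Suc (Suc k)) (X * p) = pderiv ((pderiv ^^ Suc k) (X * p))"
    by (simp only: funpow.simps(2)[of "Suc k"] o_def)
  also have "\<dots> = (pderiv ^^ Suc k) p + X * pderiv ((pderiv ^^ Suc k) p) +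
      of_nat (Suc k) * pderiv ((pderiv ^^ k) p)"
    by (simp only: Suc.IH pderiv_add pderiv_X_mult pderiv_of_nat_mult)
  also have "\<dots> = X * (pderiv ^^ Suc (Suc k)) p + of_nat (Suc (Suc k)) * (pderiv ^^ Suc k) p"
    by (simp only: funpow.simps o_def of_nat_Suc) algebra
  finally show ?case .
qed

lemma pderiv_U_power: "pderiv (U ^ Suc m) = of_nat (2 * Suc m) * (X * U ^ m)"
proof -
  have "pderiv U = of_nat 2 * X"
    by (simp add: pderiv_pCons numeral_poly)
  then show ?thesis
    unfolding pderiv_power_Suc by (simp only: flip: of_nat_mult_conv_smult) (simp only: of_nat_mult ac_simps)
qed

text \<open>
  For \<open>m \<ge> 1\<close> this is the antiderivative of \<open>legendre m\<close> that vanishes at the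
  endpoints. Its value for \<open>m = 0\<close> only ever occurs with the factor 0.
\<close>

definition legendre_prim :: "nat \<Rightarrow> real poly" where
  "legendre_prim m = smult (1 / (2 ^ m * fact m)) ((pderiv ^^ (m - 1)) (U ^ m))"

lemma legendre_0: "legendre 0 = 1"
  by (simp add: legendre_def)

text \<open>
  One derivative of \<open>U ^ Suc m\<close> produces the factor \<open>X\<close>; the Leibniz rule for the other
  \<open>m\<close> derivatives leaves just two terms, as \<open>X\<close> is linear.
\<close>

lemma legendre_Suc: "legendre (Suc m) = X * legendre m + of_nat m * legendre_prim m"
proof -
  let ?c = "1 / (2 ^ m * fact m) :: real"
  have "(pderiv ^^ Suc m) (U ^ Suc m) = (pderiv ^^ m) (pderiv (U ^ Suc m))"
    by (simp only: funpow_Suc_right o_def)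
  also have "\<dots> = of_nat (2 * Suc m) * (pderiv ^^ m) (X * U ^ m)"
    by (simp only: pderiv_U_power higher_pderiv_of_nat_mult)
  also have "(pderiv ^^ m) (X * U ^ m) =
      X * (pderiv ^^ m) (U ^ m) + of_nat m * (pderiv ^^ (m - 1)) (U ^ m)"
    by (cases m) (simp_all only: higher_pderiv_X_mult diff_Suc_1 funpow_0, simp)
  finally have "legendre (Suc m) = smult (1 / (2 ^ Suc m * fact (Suc m)))
      (of_nat (2 * Suc m) * (X * (pderiv ^^ m) (U ^ m) + of_nat m * (pderiv ^^ (m - 1)) (U ^ m)))"
    by (simp only: legendre_def)
  also have "\<dots> = smult ?c (X * (pderiv ^^ m) (U ^ m) + of_nat m * (pderiv ^^ (m - 1)) (U ^ m))"
  proof -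
    have "1 / (2 ^ Suc m * fact (Suc m)) * real (2 * Suc m) = ?c"
      by (simp add: divide_simps)
    then show ?thesis
      by (simp only: of_nat_mult_conv_smult[of "2 * Suc m"] smult_smult)
  qed
  also have "\<dots> = X * legendre m + of_nat m * legendre_prim m"
    by (simp add: legendre_def legendre_prim_def smult_add_right)
  finally show ?thesis .
qed

lemma higher_pderiv_X_mult_pderiv:
  "(pderiv ^^ k) (X * pderiv u) = X * (pderiv ^^ Suc k) u + of_nat k * (pderiv ^^ k) u"
proof (cases k)
  case 0
  then show ?thesis by simp
next
  case (Suc j)
  have "(pderiv ^^ i) (pderiv u) = (pderiv ^^ Suc i) u" for i
    by (simp only: funpow_Suc_right o_def)
  then show ?thesis
    by (simp only: Suc higher_pderiv_X_mult)
qed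

text \<open>
  With \<open>u = U ^ Suc k\<close>, differentiate the identity \<open>U * u' = 2 * (k + 1) * X * u\<close>
  \<open>k + 1\<close> times by the Leibniz rule. Both sides involve only the three consecutive derivatives
  \<open>a\<close>, \<open>b\<close>, \<open>c\<close> of \<open>u\<close>, and the terms with \<open>b\<close> cancel.
\<close>

lemma U_times_higher_pderiv_U_power:
  "U * (pderiv ^^ Suc (Suc k)) (U ^ Suc k) =
     of_nat (Suc k * Suc (Suc k)) * (pderiv ^^ k) (U ^ Suc k)"
proof -
  define u where "u = U ^ Suc k"
  define a b c where "a = (pderiv ^^ k) u" and "b = (pderiv ^^ Suc k) u"
    and "c = (pderiv ^^ Suc (Suc k)) u"
  define K :: "real poly" where "K = of_nat k"
  have D: "(pderiv ^^ i) (p - q) = (pderiv ^^ i) p - (pderiv ^^ i) q" for i and p q :: "real poly"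
    by (induction i) (simp_all add: pderiv_diff)
  have shift: "(pderiv ^^ i) (pderiv u) = (pderiv ^^ Suc i) u" for i
    by (simp only: funpow_Suc_right o_def)
  have eq: "X * (X * pderiv u) - pderiv u = of_nat (2 * Suc k) * (X * u)"
  proof -
    have "U * pderiv u = of_nat (2 * Suc k) * (X * u)"
      unfolding u_def pderiv_U_power by (simp only: power_Suc ac_simps)
    then show ?thesis
      by (simp only: U_eq left_diff_distrib mult.assoc mult_1_left)
  qed
  have "(pderiv ^^ Suc k) (X * (X * pderiv u) - pderiv u) =
      (X * (X * c + (K + 1) * b) + (K + 1) * (X * b + K * a)) - c"
    by (simp only: D higher_pderiv_X_mult higher_pderiv_X_mult_pderiv shift a_def b_def c_def K_def
        of_nat_Suc add.commute)
  moreover have "(pderiv ^^ Suc k) (of_nat (2 * Suc k) * (X * u)) =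
      2 * (K + 1) * (X * b + (K + 1) * a)"
    by (simp only: higher_pderiv_of_nat_mult higher_pderiv_X_mult flip: a_def b_def)
       (simp only: K_def of_nat_Suc of_nat_mult of_nat_numeral add.commute)
  ultimately have "(X * (X * c + (K + 1) * b) + (K + 1) * (X * b + K * a)) - c =
      2 * (K + 1) * (X * b + (K + 1) * a)"
    using eq by simp
  then have "(X * X - 1) * c = (K + 1) * (K + 2) * a"
    by algebra
  then show ?thesis
    by (simp only: U_eq a_def c_def u_def K_def of_nat_Suc of_nat_mult one_add_one[symmetric] ac_simps)
qed

lemma U_times_pderiv_legendre:
  "U * pderiv (legendre m) = of_nat (m * Suc m) * legendre_prim m"
proof (cases m)
  case 0
  then show ?thesis by (simp add: legendre_0)
next
  case (Suc k)
  have "U * pderiv (legendre m) =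
      smult (1 / (2 ^ m * fact m)) (U * (pderiv ^^ Suc (Suc k)) (U ^ Suc k))"
    by (simp only: legendre_def Suc pderiv_smult mult_smult_right funpow.simps(2) o_def)
  then show ?thesis
    by (simp only: U_times_higher_pderiv_U_power Suc legendre_prim_def mult_smult_right diff_Suc_1)
qed

text \<open>
  Eliminating the antiderivative between \<open>legendre_Suc\<close> and
  \<open>U_times_pderiv_legendre\<close>. This relation and
  \<open>pderiv_legendre_Suc\<close> determine the Legendre polynomials; the differential equation and
  the values at the endpoints follow from them by algebra.
\<close>

lemma U_times_pderiv_legendre_eq_Suc:
  "U * pderiv (legendre m) = of_nat (Suc m) * (legendre (Suc m) - X * legendre m)"
  by (simp only: U_times_pderiv_legendre legendre_Suc of_nat_mult) algebra

lemma pderiv_legendre_Suc: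
  "pderiv (legendre (Suc m)) = X * pderiv (legendre m) + of_nat (Suc m) * legendre m"
proof -
  have "of_nat m * pderiv (legendre_prim m) = of_nat m * legendre m"
  proof (cases m)
    case (Suc k)
    then show ?thesis
      by (simp add: legendre_def legendre_prim_def pderiv_smult)
  qed simp
  then show ?thesis
    unfolding legendre_Suc
    by (simp only: pderiv_add pderiv_X_mult pderiv_of_nat_mult) (simp add: algebra_simps)
qed

lemma U_times_pderiv_legendre_Suc:
  "U * pderiv (legendre (Suc m)) = of_nat (Suc m) * (X * legendre (Suc m) - legendre m)"
proof -
  define P Q P' Q' K where "P = legendre m" and "Q = legendre (Suc m)"
    and "P' = pderiv P" and "Q' = pderiv Q" and "K = (of_nat (Suc m) :: real poly)"
  have "(X * X - 1) * P' = K * (Q - X * P)"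
    using U_times_pderiv_legendre_eq_Suc[of m] by (simp only: U_eq P_def Q_def P'_def K_def)
  moreover have "Q' = X * P' + K * P"
    using pderiv_legendre_Suc[of m] by (simp only: P_def Q_def P'_def Q'_def K_def)
  ultimately have "(X * X - 1) * Q' = K * (X * Q - P)"
    by algebra
  then show ?thesis
    by (simp only: U_eq P_def Q_def Q'_def K_def)
qed

lemma legendre_ODE:
  "pderiv (U * pderiv (legendre m)) = of_nat (m * Suc m) * legendre m"
proof -
  have "pderiv (U * pderiv (legendre m)) =
      of_nat (Suc m) * (pderiv (legendre (Suc m)) - (legendre m + X * pderiv (legendre m)))"
    by (simp only: U_times_pderiv_legendre_eq_Suc pderiv_of_nat_mult pderiv_diff pderiv_X_mult)
  also have "\<dots> = of_nat (m * Suc m) * legendre m"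
    by (simp only: pderiv_legendre_Suc of_nat_mult of_nat_Suc) algebra
  finally show ?thesis .
qed

text \<open>
  At the endpoints \<open>U\<close> vanishes, so \<open>U_times_pderiv_legendre_eq_Suc\<close> ties the values of
  consecutive Legendre polynomials to each other. Likewise the differential equation gives the
  derivative there, because the term with the second derivative drops out.
\<close>

lemma poly_legendre_1: "poly (legendre m) 1 = 1"
proof (induction m)
  case (Suc m)
  have "real (Suc m) * (poly (legendre (Suc m)) 1 - poly (legendre m) 1) = 0"
    using arg_cong[OF U_times_pderiv_legendre_eq_Suc[of m], of "\<lambda>p. poly p 1"]
    by (simp del: of_nat_Suc)
  with Suc show ?case by simp
qed (simp add: legendre_0)

lemma poly_legendre_minus_1: "poly (legendre m) (-1) = (-1) ^ m"
proof (induction m)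
  case (Suc m)
  have "real (Suc m) * (poly (legendre (Suc m)) (-1) + poly (legendre m) (-1)) = 0"
    using arg_cong[OF U_times_pderiv_legendre_eq_Suc[of m], of "\<lambda>p. poly p (-1)"]
    by (simp del: of_nat_Suc)
  with Suc show ?case by simp
qed (simp add: legendre_0)

lemma poly_pderiv_legendre_1: "poly (pderiv (legendre m)) 1 = real m * (real m + 1) / 2"
  using arg_cong[OF legendre_ODE[of m, unfolded pderiv_mult], of "\<lambda>p. poly p 1"]
  by (simp add: pderiv_pCons poly_legendre_1 algebra_simps)

lemma poly_pderiv_legendre_minus_1:
  "poly (pderiv (legendre m)) (-1) = (-1) ^ Suc m * (real m * (real m + 1) / 2)"
  using arg_cong[OF legendre_ODE[of m, unfolded pderiv_mult], of "\<lambda>p. poly p (-1)"]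
  by (simp add: pderiv_pCons poly_legendre_minus_1 algebra_simps)

lemma legendre_nonzero: "legendre m \<noteq> 0"
  using poly_legendre_1[of m] by auto

lemma degree_legendre: "degree (legendre m) = m"
proof -
  have "degree ((pderiv ^^ k) p) = degree p - k" for k and p :: "real poly"
    by (induction k) (simp_all add: degree_pderiv)
  then show ?thesis
    by (simp add: legendre_def degree_power_eq)
qed

text \<open>
  The operator \<open>p \<mapsto> (U * p')'\<close> is symmetric, since \<open>U\<close> vanishes at the endpoints. It has
  \<open>legendre m\<close> as eigenvector for \<open>m * (m + 1)\<close> and maps \<open>q\<close> of degree \<open>k\<close> to
  \<open>k * (k + 1) * q\<close> up to a remainder \<open>r\<close> of smaller degree. The two eigenvalues differ for
  \<open>k < m\<close>, so orthogonality to \<open>r\<close> gives orthogonality to \<open>q\<close>.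
\<close>

lemma legendre_orthogonal:
  assumes "degree q < m"
  shows "poly_integral (legendre m * q) = 0"
  using assms
proof (induction "degree q" arbitrary: q rule: less_induct)
  case less
  define k where "k = degree q"
  define r where "r = pderiv (U * pderiv q) - of_nat (k * Suc k) * q"
  have "coeff r i = 0" if "i \<ge> k" for i
  proof -
    have U: "U * p = pCons 0 (pCons 0 p) - p" for p
      by simp
    have "coeff (pderiv (U * pderiv q)) i =
        real (Suc i) * (real i * coeff q i - real (Suc (Suc i)) * coeff q (Suc (Suc i)))"
      unfolding coeff_pderiv U by (cases i) (simp_all add: coeff_pderiv)
    moreover have "coeff q j = 0" if "j > k" for j
      using that by (simp add: k_def coeff_eq_0)
    ultimately show ?thesis
      using that by (cases "i = k") (auto simp: r_def of_nat_poly algebra_simps)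
  qed
  then have r: "r = 0 \<or> degree r < k"
    by (metis leading_coeff_0_iff not_le_imp_less)
  have "poly_integral (legendre m * r) = 0"
    using r less by (auto simp: k_def)
  moreover have "pderiv (U * (pderiv (legendre m) * q - legendre m * pderiv q)) =
      smult (real (m * Suc m) - real (k * Suc k)) (legendre m * q) - legendre m * r"
  proof -
    have "pderiv (U * (pderiv (legendre m) * q - legendre m * pderiv q)) =
        pderiv (U * pderiv (legendre m)) * q - legendre m * pderiv (U * pderiv q)"
      by (simp only: pderiv_mult pderiv_diff right_diff_distrib) algebra
    also have "\<dots> = of_nat (m * Suc m) * legendre m * q - legendre m * (r + of_nat (k * Suc k) * q)"
      by (simp only: legendre_ODE r_def diff_add_cancel)
    also have "\<dots> = of_nat (m * Suc m) * (legendre m * q) - of_nat (k * Suc k) * (legendre m * q)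
        - legendre m * r"
      by algebra
    finally show ?thesis by (simp only: of_nat_mult_conv_smult smult_diff_left)
  qed
  then have "(real (m * Suc m) - real (k * Suc k)) * poly_integral (legendre m * q) -
      poly_integral (legendre m * r) = 0"
    using poly_integral_pderiv[of "U * (pderiv (legendre m) * q - legendre m * pderiv q)"]
    by (simp add: poly_integral_diff poly_integral_smult del: of_nat_mult of_nat_Suc)
  moreover have "k * Suc k < m * Suc m"
    using less.prems by (intro mult_strict_mono) (auto simp: k_def)
  ultimately show ?case by (simp del: of_nat_mult of_nat_Suc mult_Suc mult_Suc_right)
qed

section \<open>Quadrature rules of Gauss type\<close>

text \<open>
  The set \<open>S\<close> consists of the roots of odd multiplicity: splitting off a root \<open>s\<close> toggles its
  membership in \<open>S\<close>. A polynomial without roots in the interval has constant sign by the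
  intermediate value theorem.
\<close>

lemma exists_sign_correcting_roots:
  assumes "p \<noteq> (0 :: real poly)"
  shows "\<exists>S \<sigma>. finite S \<and> S \<subseteq> {x\<in>{-1<..<1}. poly p x = 0} \<and> \<sigma> \<noteq> 0 \<and>
    (\<forall>x\<in>{-1<..<1}. \<sigma> * (poly p x * (\<Prod>s\<in>S. x - s)) \<ge> 0)"
  using assms
proof (induction "degree p" arbitrary: p rule: less_induct)
  case less
  show ?case
  proof (cases "\<exists>s\<in>{-1<..<1}. poly p s = 0")
    case False
    have "poly p 0 * poly p x \<ge> 0" if x: "x \<in> {-1<..<1}" for x
    proof (rule ccontr)
      assume "\<not> poly p 0 * poly p x \<ge> 0"
      then have neg: "poly p 0 * poly p x < 0" "poly p x * poly p 0 < 0"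
        by (simp_all add: mult.commute)
      then have "x \<noteq> 0" using zero_le_square[of "poly p 0"] by force
      then consider "0 < x" | "x < 0" by linarith
      then show False
      proof cases
        case 1
        then show False using poly_IVT[OF 1 neg(1)] x False by force
      next
        case 2
        then show False using poly_IVT[OF 2 neg(2)] x False by force
      qed
    qed
    moreover have "poly p 0 \<noteq> 0" using False by auto
    ultimately show ?thesis
      by (intro exI[of _ "{}"] exI[of _ "poly p 0"]) auto
  next
    case True
    then obtain s q where s: "s \<in> {-1<..<1}" and p: "p = [:- s, 1:] * q"
      by (auto simp: poly_eq_0_iff_dvd elim!: dvdE)
    have "q \<noteq> 0" using p less.prems by auto
    then have "degree q < degree p"
      unfolding p by (subst degree_mult_eq) auto
    then obtain S \<sigma> where S: "finite S" "S \<subseteq> {x\<in>{-1<..<1}. poly q x = 0}" "\<sigma> \<noteq> 0"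
      and sign: "\<And>x. x \<in> {-1<..<1} \<Longrightarrow> \<sigma> * (poly q x * (\<Prod>s\<in>S. x - s)) \<ge> 0"
      using less.hyps[OF _ \<open>q \<noteq> 0\<close>] by blast
    have pq: "poly p x = (x - s) * poly q x" for x
      by (simp add: p algebra_simps)
    show ?thesis
    proof (cases "s \<in> S")
      case True
      have "poly p x * (\<Prod>t\<in>S - {s}. x - t) = poly q x * (\<Prod>t\<in>S. x - t)" for x
        using S(1) True by (simp add: pq prod.remove[of S s])
      then have "\<sigma> * (poly p x * (\<Prod>t\<in>S - {s}. x - t)) \<ge> 0" if "x \<in> {-1<..<1}" for x
        using sign[OF that] by simp
      then show ?thesis
        using S s by (intro exI[of _ "S - {s}"] exI[of _ \<sigma>]) (auto simp: pq)
    next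
      case False
      have "\<sigma> * (poly p x * (\<Prod>t\<in>insert s S. x - t)) =
          (x - s)\<^sup>2 * (\<sigma> * (poly q x * (\<Prod>t\<in>S. x - t)))" for x
        using S(1) False by (simp add: pq power2_eq_square)
      then have "\<sigma> * (poly p x * (\<Prod>t\<in>insert s S. x - t)) \<ge> 0" if "x \<in> {-1<..<1}" for x
        using mult_nonneg_nonneg[OF zero_le_power2[of "x - s"] sign[OF that]] by metis
      then show ?thesis
        using S s by (intro exI[of _ "insert s S"] exI[of _ \<sigma>]) (auto simp: pq)
    qed
  qed
qed

text \<open>
  The weights are the integrals of the Lagrange basis polynomials \<open>l x\<close>.
\<close>

lemma exists_interpolatory_weights:
  assumes "finite (S :: real set)"
  shows "\<exists>W. \<forall>p. degree p < card S \<longrightarrow> poly_integral p = (\<Sum>x\<in>S. W x * poly p x)"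
proof -
  have "\<forall>x. \<exists>l. degree l \<le> card S - 1 \<and> (\<forall>y\<in>S. poly l y = (if y = x then 1 else 0))"
    using exists_interpolating_poly[OF assms] by (intro allI)
  then obtain l where l: "\<And>x. degree (l x) \<le> card S - 1"
    "\<And>x y. y \<in> S \<Longrightarrow> poly (l x) y = (if y = x then 1 else 0)"
    by metis
  have "poly_integral p = (\<Sum>x\<in>S. poly_integral (l x) * poly p x)" if "degree p < card S" for p
  proof -
    define d where "d = p - (\<Sum>x\<in>S. smult (poly p x) (l x))"
    have "degree (\<Sum>x\<in>S. smult (poly p x) (l x)) \<le> card S - 1"
      using assms l(1) by (intro degree_sum_le) (auto intro: order.trans[OF degree_smult_le])
    then have "degree d < card S"
      using that unfolding d_def by (intro le_less_trans[OF degree_diff_le[of _ "card S - 1"]]) auto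
    moreover have "poly d y = 0" if "y \<in> S" for y
      using assms that by (simp add: d_def poly_sum l(2) if_distrib sum.delta cong: if_cong)
    ultimately have "d = 0"
      using card_poly_roots_bound[of d] card_mono[OF poly_roots_finite[of d], of S] by fastforce
    then have "p = (\<Sum>x\<in>S. smult (poly p x) (l x))" by (simp add: d_def)
    then have "poly_integral p = poly_integral (\<Sum>x\<in>S. smult (poly p x) (l x))" by simp
    then show ?thesis
      by (simp add: poly_integral_sum poly_integral_smult mult.commute)
  qed
  then show ?thesis by (intro exI allI impI)
qed

text \<open>
  The product rule, arranged so that for a node \<open>x\<close> and \<open>Q = (X - x) * h\<close> the polynomial
  \<open>Q = L * h\<close> becomes visible.
\<close>

lemma pderiv_mult_linear_square:
  fixes \<omega> L h :: "real poly"
  assumes "pderiv L = 1"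
  shows "pderiv (\<omega> * L * h\<^sup>2) =
    pderiv \<omega> * (L * h) * h + \<omega> * h\<^sup>2 + (\<omega> * (L * h) * pderiv h + \<omega> * (L * h) * pderiv h)"
  unfolding power2_eq_square pderiv_mult assms by (simp add: distrib_left distrib_right ac_simps)

text \<open>
  The common frame of all rules considered. The roots of \<open>\<omega>\<close> are the prescribed nodes and the
  roots of \<open>Q\<close> the free ones. The rules of Gauss, Lobatto and Radau arise for
  \<open>\<omega> = 1\<close>, \<open>1 - x\<^sup>2\<close> and \<open>1 + x\<close>.
\<close>

locale gauss_type =
  fixes \<omega> Q :: "real poly"
  assumes weight_pos: "\<And>x. x \<in> {-1<..<1} \<Longrightarrow> poly \<omega> x > 0"
    and card_weight_roots: "card {x. poly \<omega> x = 0} = degree \<omega>"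
    and nonzero: "Q \<noteq> 0"
    and orthogonal: "\<And>q. degree q < degree Q \<Longrightarrow> poly_integral (\<omega> * Q * q) = 0"
begin

lemma weight_nonzero: "\<omega> \<noteq> 0"
  using weight_pos[of 0] by auto

lemma finite_roots: "finite {x. poly Q x = 0}" "finite {x. poly \<omega> x = 0}"
  using nonzero weight_nonzero by (auto intro: poly_roots_finite)

text \<open>
  If \<open>Q\<close> had too few roots of odd multiplicity inside the interval, then multiplying it by
  their linear factors \<open>q\<close> would give a polynomial of constant sign whose weighted integral is 0 by
  orthogonality.
\<close>

lemma roots_inside: "{x. poly Q x = 0} \<subseteq> {-1<..<1}"
  and card_roots: "card {x. poly Q x = 0} = degree Q"
proof -
  obtain S \<sigma> where S: "finite S" "S \<subseteq> {x\<in>{-1<..<1}. poly Q x = 0}" "\<sigma> \<noteq> 0"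
    and sign: "\<And>x. x \<in> {-1<..<1} \<Longrightarrow> \<sigma> * (poly Q x * (\<Prod>s\<in>S. x - s)) \<ge> 0"
    using exists_sign_correcting_roots[OF nonzero] by blast
  define q where "q = (\<Prod>s\<in>S. [:- s, 1:])"
  have q: "poly q x = (\<Prod>s\<in>S. x - s)" for x
    by (simp add: q_def poly_prod)
  have "q \<noteq> 0" "degree q = card S"
    using S(1) by (simp_all add: q_def degree_prod_eq_sum_degree)
  have "degree Q \<le> card S"
  proof (rule ccontr)
    assume "\<not> degree Q \<le> card S"
    then have "poly_integral (smult \<sigma> (\<omega> * Q * q)) = 0"
      using \<open>degree q = card S\<close> orthogonal by (simp add: poly_integral_smult)
    moreover have "poly (smult \<sigma> (\<omega> * Q * q)) x \<ge> 0" if "x \<in> {-1<..<1}" for x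
      using mult_nonneg_nonneg[OF less_imp_le[OF weight_pos[OF that]] sign[OF that]]
      by (simp add: q ac_simps)
    ultimately have "smult \<sigma> (\<omega> * Q * q) = 0"
      by (rule poly_integral_nonneg_eq_0)
    then show False
      using \<open>q \<noteq> 0\<close> nonzero weight_nonzero S(3) by simp
  qed
  moreover have "card {x. poly Q x = 0} \<le> degree Q"
    by (rule card_poly_roots_bound) (rule nonzero)
  moreover have "S \<subseteq> {x. poly Q x = 0}" using S(2) by blast
  ultimately have "S = {x. poly Q x = 0}" "card {x. poly Q x = 0} = degree Q"
    using card_seteq[OF finite_roots(1), of S] card_mono[OF finite_roots(1), of S] by auto
  then show "{x. poly Q x = 0} \<subseteq> {-1<..<1}" "card {x. poly Q x = 0} = degree Q"
    using S(2) by blast+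
qed

lemma weight_at_root: "poly Q x = 0 \<Longrightarrow> poly \<omega> x > 0"
  using roots_inside weight_pos by blast

text \<open>
  Division by the node polynomial \<open>\<Omega>\<close> leaves a quotient of degree below that of \<open>Q\<close>,
  which orthogonality makes invisible to the integral, and a remainder which the interpolatory rule
  integrates exactly. One function \<open>W\<close> holds the weights of both kinds of nodes.
\<close>

lemma exists_weights:
  obtains W where "\<And>p. degree p < degree \<omega> + 2 * degree Q \<Longrightarrow> poly_integral p =
    (\<Sum>x | poly \<omega> x = 0. W x * poly p x) + (\<Sum>x | poly Q x = 0. W x * poly p x)"
proof -
  let ?E = "{x. poly \<omega> x = 0}" and ?R = "{x. poly Q x = 0}"
  have disj: "?E \<inter> ?R = {}" using weight_at_root by fastforce
  define \<Omega> where "\<Omega> = \<omega> * Q"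
  have \<Omega>: "\<Omega> \<noteq> 0" "degree \<Omega> = degree \<omega> + degree Q"
    using nonzero weight_nonzero by (simp_all add: \<Omega>_def degree_mult_eq)
  have card: "card (?E \<union> ?R) = degree \<Omega>"
    using disj finite_roots by (simp add: card_Un_disjoint \<Omega>(2) card_roots card_weight_roots)
  obtain W where W: "\<And>p. degree p < degree \<Omega> \<Longrightarrow> poly_integral p = (\<Sum>x\<in>?E \<union> ?R. W x * poly p x)"
    using exists_interpolatory_weights[of "?E \<union> ?R"] finite_roots card by auto
  have "poly_integral p = (\<Sum>x\<in>?E. W x * poly p x) + (\<Sum>x\<in>?R. W x * poly p x)"
    if p: "degree p < degree \<omega> + 2 * degree Q" for p
  proof -
    define d r where "d = p div \<Omega>" and "r = p mod \<Omega>"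
    have pdr: "p = \<Omega> * d + r" by (simp add: d_def r_def)
    have r: "r = 0 \<or> degree r < degree \<Omega>"
      using degree_mod_less[OF \<Omega>(1)] by (simp add: r_def)
    have "poly_integral (\<Omega> * d) = 0"
    proof (cases "d = 0")
      case False
      then have "degree (\<Omega> * d) = degree \<Omega> + degree d" by (simp add: degree_mult_eq \<Omega>(1))
      then have "degree p = degree \<Omega> + degree d" if "r \<noteq> 0"
        using r that unfolding pdr by (subst degree_add_eq_left) auto
      then have "degree p = degree \<Omega> + degree d"
        using \<open>degree (\<Omega> * d) = degree \<Omega> + degree d\<close> pdr by (cases "r = 0") auto
      then have "degree d < degree Q" using p \<Omega>(2) by simp
      then show ?thesis using orthogonal by (simp add: \<Omega>_def)
    qed simp
    then have "poly_integral p = poly_integral r"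
      unfolding pdr by (simp add: poly_integral_add)
    also have "\<dots> = (\<Sum>x\<in>?E \<union> ?R. W x * poly r x)"
      using r W by auto
    also have "\<dots> = (\<Sum>x\<in>?E \<union> ?R. W x * poly p x)"
      by (intro sum.cong) (auto simp: pdr \<Omega>_def)
    also have "\<dots> = (\<Sum>x\<in>?E. W x * poly p x) + (\<Sum>x\<in>?R. W x * poly p x)"
      using finite_roots disj by (simp add: sum.union_disjoint)
    finally show ?thesis .
  qed
  then show ?thesis using that by blast
qed

text \<open>
  Let \<open>h = Q / (X - x)\<close>. The rule evaluates the integral of \<open>\<omega> * h\<^sup>2\<close> to the left-hand side,
  because \<open>h\<close> vanishes at all other free nodes. On the other hand, integrating the
  derivative of \<open>\<omega> * (X - x) * h\<^sup>2\<close> expresses this integral by boundary terms and the integral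
  of \<open>\<omega>' * Q * h\<close>, the terms with \<open>h'\<close> being orthogonal to \<open>\<omega> * Q\<close>. The latter is once
  more computed by the rule, which sees only the prescribed nodes because of the factor \<open>Q\<close>. So
  a weight at a free node is expressed by data at the endpoints and at the prescribed nodes.
\<close>

lemma weight_identity:
  assumes rule: "\<And>p. degree p < degree \<omega> + 2 * degree Q \<Longrightarrow> poly_integral p =
    (\<Sum>x | poly \<omega> x = 0. W x * poly p x) + (\<Sum>x | poly Q x = 0. W x * poly p x)"
    and x: "poly Q x = 0"
  shows "W x * poly \<omega> x * (poly (pderiv Q) x)\<^sup>2 =
    poly \<omega> 1 * (poly Q 1)\<^sup>2 / (1 - x) + poly \<omega> (-1) * (poly Q (-1))\<^sup>2 / (1 + x) +
    (\<Sum>e | poly \<omega> e = 0. W e * poly (pderiv \<omega>) e * (poly Q e)\<^sup>2 / (x - e))"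
proof -
  obtain h where Q: "Q = [:- x, 1:] * h"
    using x unfolding poly_eq_0_iff_dvd by (elim dvdE)
  have poly_Q: "poly Q y = (y - x) * poly h y" for y
    by (simp add: Q algebra_simps)
  have "h \<noteq> 0" using nonzero Q by auto
  then have deg: "degree Q = Suc (degree h)"
    unfolding Q by (subst degree_mult_eq) auto
  have dQ: "poly (pderiv Q) x = poly h x"
    unfolding Q pderiv_mult by (simp add: pderiv_pCons)
  have x1: "x \<noteq> 1" "x \<noteq> -1" using roots_inside x by auto
  have "pderiv [:- x, 1:] = 1" by (simp add: pderiv_pCons)
  then have "pderiv (\<omega> * [:- x, 1:] * h\<^sup>2) =
      pderiv \<omega> * Q * h + \<omega> * h\<^sup>2 + (\<omega> * Q * pderiv h + \<omega> * Q * pderiv h)"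
    unfolding Q by (rule pderiv_mult_linear_square)
  moreover have "poly_integral (\<omega> * Q * pderiv h) = 0"
    using deg by (intro orthogonal) (simp add: degree_pderiv)
  ultimately have "poly_integral (\<omega> * h\<^sup>2) + poly_integral (pderiv \<omega> * Q * h) =
      poly \<omega> 1 * (1 - x) * (poly h 1)\<^sup>2 - poly \<omega> (-1) * (- 1 - x) * (poly h (-1))\<^sup>2"
    using poly_integral_pderiv[of "\<omega> * [:- x, 1:] * h\<^sup>2"]
    by (simp only: poly_integral_add) (simp add: algebra_simps)
  also have "\<dots> = poly \<omega> 1 * (poly Q 1)\<^sup>2 / (1 - x) + poly \<omega> (-1) * (poly Q (-1))\<^sup>2 / (1 + x)"
  proof -
    have q1: "(poly Q 1)\<^sup>2 / (1 - x) = (1 - x) * (poly h 1)\<^sup>2"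
      using x1(1) by (simp add: poly_Q power2_eq_square)
    have q2: "(poly Q (-1))\<^sup>2 / (1 + x) = (1 + x) * (poly h (-1))\<^sup>2"
    proof -
      have "poly Q (-1) = - ((1 + x) * poly h (-1))" "1 + x \<noteq> 0"
        using x1(2) by (simp_all add: poly_Q algebra_simps add_eq_0_iff)
      then show ?thesis by (simp add: power2_eq_square)
    qed
    show ?thesis
      unfolding times_divide_eq_right [symmetric] q1 q2 by (simp add: algebra_simps)
  qed
  finally have parts: "poly_integral (\<omega> * h\<^sup>2) + poly_integral (pderiv \<omega> * Q * h) = \<dots>" .
  have "poly_integral (\<omega> * h\<^sup>2) = (\<Sum>y | poly Q y = 0. W y * poly \<omega> y * (poly h y)\<^sup>2)"
  proof (subst rule)
    show "degree (\<omega> * h\<^sup>2) < degree \<omega> + 2 * degree Q"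
      using deg weight_nonzero \<open>h \<noteq> 0\<close> by (simp add: degree_mult_eq degree_power_eq)
  qed (simp add: mult.assoc)
  also have "\<dots> = (\<Sum>y | poly Q y = 0. if y = x then W y * poly \<omega> y * (poly h y)\<^sup>2 else 0)"
    by (intro sum.cong) (auto simp: poly_Q)
  also have "\<dots> = W x * poly \<omega> x * (poly (pderiv Q) x)\<^sup>2"
    using x finite_roots(1) by (simp add: dQ)
  finally have lhs: "poly_integral (\<omega> * h\<^sup>2) = W x * poly \<omega> x * (poly (pderiv Q) x)\<^sup>2" .
  have "poly_integral (pderiv \<omega> * Q * h) =
      (\<Sum>e | poly \<omega> e = 0. W e * (poly (pderiv \<omega>) e * poly Q e * poly h e))"
  proof (subst rule)
    have "degree (pderiv \<omega> * Q * h) \<le> degree \<omega> + degree Q + degree h"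
      by (intro order.trans[OF degree_mult_le] add_mono) (auto simp: degree_pderiv)
    then show "degree (pderiv \<omega> * Q * h) < degree \<omega> + 2 * degree Q"
      using deg by simp
  qed simp
  also have "\<dots> = - (\<Sum>e | poly \<omega> e = 0. W e * poly (pderiv \<omega>) e * (poly Q e)\<^sup>2 / (x - e))"
    unfolding sum_negf[symmetric]
  proof (intro sum.cong refl)
    fix e assume "e \<in> {e. poly \<omega> e = 0}"
    then have "x - e \<noteq> 0" using weight_at_root[OF x] by auto
    then show "W e * (poly (pderiv \<omega>) e * poly Q e * poly h e) =
        - (W e * poly (pderiv \<omega>) e * (poly Q e)\<^sup>2 / (x - e))"
      by (simp add: poly_Q power2_eq_square field_simps)
  qed
  finally show ?thesis using parts lhs by simp
qed

end

section \<open>Exactness of the Gauss, Lobatto and Radau rules\<close>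

lemma partial_fractions:
  fixes x :: real
  assumes "-1 < x" "x < 1"
  shows "(1 / (1 - x) + 1 / (1 + x)) * (1 - x\<^sup>2) = 2"
proof -
  have "1 - x\<^sup>2 = (1 - x) * (1 + x)" by (simp add: power2_eq_square algebra_simps)
  then show ?thesis using assms by (simp add: distrib_right)
qed

lemma gauss_type_legendre: "gauss_type 1 (legendre n)"
proof
  show "poly_integral (1 * legendre n * q) = 0" if "degree q < degree (legendre n)" for q
    using legendre_orthogonal[of q n] that by (simp add: degree_legendre)
qed (use legendre_nonzero in auto)

text \<open>
  The general identity gives \<open>W x = 2 / ((1 - x\<^sup>2) * P\<^sub>n'(x)\<^sup>2)\<close>; at a root of \<open>P\<^sub>n\<close> the
  derivative is expressed by \<open>P\<^bsub>n+1\<^esub>\<close>.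
\<close>

lemma gauss_exact:
  obtains W where
    "\<And>p. degree p < 2 * n \<Longrightarrow> poly_integral p = (\<Sum>x | poly (legendre n) x = 0. W x * poly p x)"
    "\<And>f. gauss n f = (\<Sum>x | poly (legendre n) x = 0. W x * f x)"
proof -
  interpret gauss_type 1 "legendre n" by (rule gauss_type_legendre)
  obtain W where W: "\<And>p. degree p < degree (1 :: real poly) + 2 * degree (legendre n) \<Longrightarrow> poly_integral p =
    (\<Sum>x | poly 1 x = 0. W x * poly p x) + (\<Sum>x | poly (legendre n) x = 0. W x * poly p x)"
    using exists_weights by blast
  have weight: "W x = 2 * (1 - x\<^sup>2) / ((real n + 1)\<^sup>2 * (poly (legendre (n + 1)) x)\<^sup>2)"
    if x: "poly (legendre n) x = 0" for x
  proof -
    define D where "D = poly (pderiv (legendre n)) x"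
    define K where "K = (real n + 1) * poly (legendre (n + 1)) x"
    have inside: "-1 < x" "x < 1" using roots_inside x by auto
    have "W x * D\<^sup>2 = 1 / (1 - x) + 1 / (1 + x)"
      using weight_identity[OF W x]
      by (simp add: D_def poly_legendre_1 poly_legendre_minus_1 power_mult [symmetric])
    then have "W x * D\<^sup>2 * (1 - x\<^sup>2) = 2"
      using partial_fractions[OF inside] by (simp only:)
    moreover have "(x\<^sup>2 - 1) * D = K"
      using arg_cong[OF U_times_pderiv_legendre_eq_Suc[of n], of "\<lambda>p. poly p x"] x
      by (simp add: D_def K_def power2_eq_square algebra_simps)
    then have "W x * K\<^sup>2 = W x * D\<^sup>2 * (1 - x\<^sup>2) * (1 - x\<^sup>2)"
      by (simp add: power2_eq_square algebra_simps flip: \<open>(x\<^sup>2 - 1) * D = K\<close>)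
    ultimately have "W x * K\<^sup>2 = 2 * (1 - x\<^sup>2)"
      by simp
    moreover have "1 - x\<^sup>2 > 0"
      using inside by (simp add: abs_square_less_1)
    ultimately have "W x = 2 * (1 - x\<^sup>2) / K\<^sup>2"
      by (cases "K = 0") (auto simp: field_simps)
    then show ?thesis by (simp add: K_def power_mult_distrib)
  qed
  show thesis
  proof (rule that)
    show "poly_integral p = (\<Sum>x | poly (legendre n) x = 0. W x * poly p x)" if "degree p < 2 * n" for p
      using W[of p] that by (simp add: degree_legendre)
    show "gauss n f = (\<Sum>x | poly (legendre n) x = 0. W x * f x)" for f
      unfolding gauss_def by (intro sum.cong) (auto simp: weight)
  qed
qed

text \<open>
  Integration by parts moves the derivative from \<open>P\<^sub>n\<close> to \<open>(1 - x\<^sup>2) * q\<close>, which is then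
  still of degree below \<open>n\<close>.
\<close>

lemma gauss_type_pderiv_legendre:
  assumes "n \<ge> 1"
  shows "gauss_type [:1, 0, -1:] (pderiv (legendre n))"
proof
  have roots: "{x::real. poly [:1, 0, -1:] x = 0} = {-1, 1}"
    by (auto simp: square_eq_1_iff algebra_simps)
  show "card {x::real. poly [:1, 0, -1:] x = 0} = degree [:1, 0, -1::real:]"
    unfolding roots by simp
  show "pderiv (legendre n) \<noteq> 0"
    using assms by (simp add: pderiv_eq_0_iff degree_legendre)
  show "poly [:1, 0, -1:] x > 0" if "x \<in> {-1<..<1}" for x :: real
    using that by (simp add: abs_square_less_1 power2_eq_square [symmetric] abs_less_iff)
  show "poly_integral ([:1, 0, -1:] * pderiv (legendre n) * q) = 0"
    if "degree q < degree (pderiv (legendre n))" for q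
  proof -
    have "degree (pderiv ([:1, 0, -1:] * q)) < n"
      using that degree_mult_le[of "[:1, 0, -1:]" q] by (simp add: degree_pderiv degree_legendre)
    then have "poly_integral (legendre n * pderiv ([:1, 0, -1:] * q)) = 0"
      by (rule legendre_orthogonal)
    moreover have "pderiv (legendre n * ([:1, 0, -1:] * q)) =
        legendre n * pderiv ([:1, 0, -1:] * q) + [:1, 0, -1:] * pderiv (legendre n) * q"
      by (simp only: pderiv_mult[of "legendre n"]) (simp only: ac_simps)
    ultimately show ?thesis
      using poly_integral_pderiv[of "legendre n * ([:1, 0, -1:] * q)"]
      by (simp only: poly_integral_add) simp
  qed
qed

text \<open>
  The polynomials \<open>(1 + x) * P\<^sub>n'\<close> and \<open>(1 - x) * P\<^sub>n'\<close> vanish at all nodes but one endpoint and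
  have elementary integrals, which gives the endpoint weights. At an interior node, where
  \<open>P\<^sub>n'\<close> vanishes, the differential equation turns the second derivative in the general identity
  into \<open>P\<^sub>n\<close>.
\<close>

lemma lobatto_exact:
  assumes "n \<ge> 1"
  obtains W where
    "\<And>p. degree p < 2 * n \<Longrightarrow> poly_integral p =
      (\<Sum>x\<in>{-1, 1}. W x * poly p x) + (\<Sum>x | poly (pderiv (legendre n)) x = 0. W x * poly p x)"
    "\<And>f. lobatto (n + 1) f =
      (\<Sum>x\<in>{-1, 1}. W x * f x) + (\<Sum>x | poly (pderiv (legendre n)) x = 0. W x * f x)"
proof -
  let ?\<omega> = "[:1, 0, -1:] :: real poly" and ?Q = "pderiv (legendre n)"
  interpret gauss_type ?\<omega> ?Q by (rule gauss_type_pderiv_legendre) (rule assms)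
  have roots: "{x. poly ?\<omega> x = 0} = {-1, 1}"
    by (auto simp: square_eq_1_iff algebra_simps)
  have deg: "degree ?\<omega> + 2 * degree ?Q = 2 * n"
    using assms by (simp add: degree_pderiv degree_legendre)
  obtain W where W: "\<And>p. degree p < 2 * n \<Longrightarrow> poly_integral p =
    (\<Sum>x | poly ?\<omega> x = 0. W x * poly p x) + (\<Sum>x | poly ?Q x = 0. W x * poly p x)"
    using exists_weights unfolding deg by blast
  define K where "K = real n * (real n + 1)"
  have "K > 0" using assms by (simp add: K_def)
  have Q1: "poly ?Q 1 = K / 2" and Qm1: "poly ?Q (-1) = - ((-1) ^ n * (K / 2))"
    by (simp_all add: K_def poly_pderiv_legendre_1 poly_pderiv_legendre_minus_1)
  have int0: "poly_integral (legendre n) = 0"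
    using legendre_orthogonal[of 1 n] assms by simp
  have test: "(\<Sum>x\<in>{-1, 1}. W x * (poly L x * poly ?Q x)) = poly L 1 - poly L (-1) * (-1) ^ n"
    if L: "degree L \<le> 1" "pderiv L = [:c:]" for L c
  proof -
    have "degree (L * ?Q) < 2 * n"
      using L(1) assms degree_mult_le[of L ?Q] by (simp add: degree_pderiv degree_legendre)
    from W[OF this] have "poly_integral (L * ?Q) = (\<Sum>x\<in>{-1, 1}. W x * (poly L x * poly ?Q x))"
      unfolding roots by simp
    moreover have "pderiv (L * legendre n) = L * ?Q + smult c (legendre n)"
      using L(2) by (simp add: pderiv_mult)
    then have "poly_integral (L * ?Q) = poly L 1 - poly L (-1) * (-1) ^ n"
      using poly_integral_pderiv[of "L * legendre n"] int0
      by (simp add: poly_integral_add poly_integral_smult poly_legendre_1 poly_legendre_minus_1)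
    ultimately show ?thesis by simp
  qed
  have W1: "W 1 = 2 / K"
    using test[of "[:1, 1:]" 1] Q1 \<open>K > 0\<close> by (simp add: pderiv_pCons field_simps)
  have Wm1: "W (-1) = 2 / K"
    using test[of "[:1, -1:]" "-1"] Qm1 \<open>K > 0\<close> by (simp add: pderiv_pCons field_simps)
  have weight: "W x = 2 / (K * (poly (legendre n) x)\<^sup>2)" if x: "poly ?Q x = 0" for x
  proof -
    define D where "D = poly (pderiv ?Q) x"
    define P where "P = poly (legendre n) x"
    have inside: "-1 < x" "x < 1" using roots_inside x by auto
    then have ne: "1 - x \<noteq> 0" "1 + x \<noteq> 0" by auto
    have "W x * (1 - x\<^sup>2) * D\<^sup>2 = K / (1 + x) - K / (x - 1)"
      using weight_identity[unfolded deg, OF W x] \<open>K > 0\<close> unfolding roots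
      by (simp add: pderiv_pCons W1 Wm1 Q1 Qm1 D_def field_simps power2_eq_square)
    also have "\<dots> = K * (1 / (1 - x) + 1 / (1 + x))"
      using minus_divide_right[of K "x - 1"] by (simp add: distrib_left)
    finally have "W x * (1 - x\<^sup>2) * D\<^sup>2 * (1 - x\<^sup>2) = K * 2"
      using partial_fractions[OF inside] by (simp only: mult.assoc)
    moreover have "(x\<^sup>2 - 1) * D = K * P"
      using arg_cong[OF legendre_ODE[of n, unfolded pderiv_mult], of "\<lambda>p. poly p x"] x
      by (simp add: D_def K_def P_def power2_eq_square algebra_simps)
    ultimately have "W x * (K * P)\<^sup>2 = 2 * K"
      by algebra
    then have "W x = 2 / (K * P\<^sup>2)"
      using \<open>K > 0\<close> by (cases "P = 0") (auto simp: field_simps power2_eq_square)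
    then show ?thesis by (simp add: P_def)
  qed
  show thesis
  proof (rule that)
    show "poly_integral p = (\<Sum>x\<in>{-1, 1}. W x * poly p x) +
        (\<Sum>x | poly ?Q x = 0. W x * poly p x)" if "degree p < 2 * n" for p
      using W[OF that] unfolding roots .
    have K: "real (n + 1) * (real (n + 1) - 1) = K"
      by (simp add: K_def)
    show "lobatto (n + 1) f = (\<Sum>x\<in>{-1, 1}. W x * f x) + (\<Sum>x | poly ?Q x = 0. W x * f x)" for f
    \<comment> \<open>The two-point rule has a clause of its own, but the general formula gives the same.\<close>
    proof (cases "n = 1")
      case True
      have "pderiv (legendre 1) = 1"
        using pderiv_legendre_Suc[of 0] by (simp add: legendre_0)
      then show ?thesis
        using True W1 Wm1 by (simp add: lobatto_def K_def)
    next
      case False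
      have "(\<Sum>x | poly ?Q x = 0. W x * f x) = (\<Sum>x | poly ?Q x = 0. 2 / (K * (poly (legendre n) x)\<^sup>2) * f x)"
        by (intro sum.cong) (simp_all add: weight)
      then show ?thesis
        using False assms W1 Wm1 unfolding lobatto_def K by simp
    qed
  qed
qed

lemma radau_poly_mult: "[:1, 1:] * radau_poly (Suc n) = legendre n + legendre (Suc n)"
proof -
  have "[:1, 1:] dvd legendre n + legendre (Suc n)"
    using poly_eq_0_iff_dvd[of "legendre n + legendre (Suc n)" "-1"]
    by (simp add: poly_legendre_minus_1)
  then show ?thesis
    by (simp only: radau_poly_def diff_Suc_1 dvd_mult_div_cancel)
qed

lemma degree_radau_poly: "degree (radau_poly (Suc n)) = n"
proof -
  have "degree ([:1, 1:] * radau_poly (Suc n)) = Suc n"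
    unfolding radau_poly_mult by (subst degree_add_eq_right) (simp_all add: degree_legendre)
  moreover from this have "radau_poly (Suc n) \<noteq> 0" by auto
  ultimately show ?thesis by (subst (asm) degree_mult_eq) auto
qed

lemma gauss_type_radau_poly: "gauss_type [:1, 1:] (radau_poly (Suc n))"
proof
  have "{x::real. poly [:1, 1:] x = 0} = {-1}" by auto
  then show "card {x::real. poly [:1, 1:] x = 0} = degree [:1, 1::real:]" by simp
  show "radau_poly (Suc n) \<noteq> 0"
  proof
    assume "radau_poly (Suc n) = 0"
    then have "poly (legendre n + legendre (Suc n)) 1 = 0"
      unfolding radau_poly_mult [symmetric] by simp
    then show False by (simp add: poly_legendre_1)
  qed
  show "poly_integral ([:1, 1:] * radau_poly (Suc n) * q) = 0" if "degree q < degree (radau_poly (Suc n))" for q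
    using that unfolding radau_poly_mult degree_radau_poly
    by (simp add: distrib_right poly_integral_add legendre_orthogonal del: poly_add)
qed auto

text \<open>
  For the endpoint weight, \<open>radau_poly\<^sup>2\<close> vanishes at all free nodes, and its integral is
  read off from the derivative of \<open>(1 + x) * radau_poly\<^sup>2\<close> by orthogonality. At a free node
  \<open>P\<^bsub>n+1\<^esub> = - P\<^sub>n\<close>, and the two derivative relations then show that \<open>P\<^sub>n\<close> and
  \<open>P\<^bsub>n+1\<^esub>\<close> have the same derivative there, which brings the general identity to the form with
  \<open>P\<^sub>n'\<close> only.
\<close>

lemma radau_exact:
  assumes "n \<ge> 1"
  obtains W where
    "\<And>p. degree p \<le> 2 * n \<Longrightarrow> poly_integral p =
      W (-1) * poly p (-1) + (\<Sum>x | poly (radau_poly (Suc n)) x = 0. W x * poly p x)"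
    "\<And>f. radau_l (Suc n) f =
      W (-1) * f (-1) + (\<Sum>x | poly (radau_poly (Suc n)) x = 0. W x * f x)"
proof -
  let ?\<omega> = "[:1, 1:] :: real poly" and ?Q = "radau_poly (Suc n)"
  interpret gauss_type ?\<omega> ?Q by (rule gauss_type_radau_poly)
  have roots: "{x. poly ?\<omega> x = 0} = {-1}" by auto
  have deg: "degree ?\<omega> + 2 * degree ?Q = Suc (2 * n)"
    by (simp add: degree_radau_poly)
  obtain W where W: "\<And>p. degree p < Suc (2 * n) \<Longrightarrow> poly_integral p =
    (\<Sum>x | poly ?\<omega> x = 0. W x * poly p x) + (\<Sum>x | poly ?Q x = 0. W x * poly p x)"
    using exists_weights unfolding deg by blast
  have prod: "(1 + x) * poly ?Q x = poly (legendre n) x + poly (legendre (Suc n)) x" for x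
    using arg_cong[OF radau_poly_mult[of n], of "\<lambda>p. poly p x"] by (simp add: algebra_simps)
  have dprod: "poly ?Q x + (1 + x) * poly (pderiv ?Q) x =
      poly (pderiv (legendre n)) x + poly (pderiv (legendre (Suc n))) x" for x
    using arg_cong[OF radau_poly_mult[of n], of "\<lambda>p. poly (pderiv p) x"]
    unfolding pderiv_mult pderiv_add by (simp add: pderiv_pCons algebra_simps)
  have Q1: "poly ?Q 1 = 1"
    using prod[of 1] by (simp add: poly_legendre_1)
  have Qm1: "poly ?Q (-1) = (-1) ^ n * (real n + 1)"
    using dprod[of "-1"] by (simp add: poly_pderiv_legendre_minus_1 field_simps)
  have Wm1: "W (-1) = 2 / (real n + 1)\<^sup>2"
  proof -
    have "pderiv (?\<omega> * ?Q\<^sup>2) = ?Q\<^sup>2 + (?\<omega> * ?Q * pderiv ?Q + ?\<omega> * ?Q * pderiv ?Q)"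
    proof -
      have "pderiv ?\<omega> = 1" by (simp add: pderiv_pCons)
      then show ?thesis
        unfolding power2_eq_square pderiv_mult by (simp only: distrib_left distrib_right ac_simps mult_1_left mult_1_right)
    qed
    moreover have "poly_integral (?\<omega> * ?Q * pderiv ?Q) = 0"
      using assms by (intro orthogonal) (simp add: degree_pderiv degree_radau_poly)
    ultimately have "poly_integral (?Q\<^sup>2) = 2"
      using poly_integral_pderiv[of "?\<omega> * ?Q\<^sup>2"] by (simp only: poly_integral_add) (simp add: Q1)
    moreover have "degree (?Q\<^sup>2) < Suc (2 * n)"
      by (simp add: degree_power_eq nonzero degree_radau_poly)
    ultimately have "2 = W (-1) * (poly ?Q (-1))\<^sup>2"
      using W[of "?Q\<^sup>2"] unfolding roots by simp
    also have "(poly ?Q (-1))\<^sup>2 = (real n + 1)\<^sup>2"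
      by (simp add: Qm1 power_mult_distrib flip: power_mult)
    finally show ?thesis by (simp add: field_simps)
  qed
  have weight: "W x = 1 / ((1 - x) * (poly (pderiv (legendre n)) x)\<^sup>2)" if x: "poly ?Q x = 0" for x
  proof -
    define D where "D = poly (pderiv (legendre n)) x"
    have inside: "-1 < x" "x < 1" using roots_inside x by auto
    then have ne: "1 - x \<noteq> 0" "1 + x \<noteq> 0" by auto
    have "poly (pderiv (legendre (Suc n))) x = D"
    proof -
      have "poly (legendre (Suc n)) x = - poly (legendre n) x"
        using prod[of x] x by simp
      then have "(x * x - 1) * D = (x * x - 1) * poly (pderiv (legendre (Suc n))) x"
        using arg_cong[OF U_times_pderiv_legendre_eq_Suc[of n], of "\<lambda>p. poly p x"]
          arg_cong[OF U_times_pderiv_legendre_Suc[of n], of "\<lambda>p. poly p x"]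
        by (simp add: D_def algebra_simps)
      moreover have "x * x - 1 = - ((1 - x) * (1 + x))" by (simp add: algebra_simps)
      ultimately show ?thesis using ne by simp
    qed
    then have dQ: "(1 + x) * poly (pderiv ?Q) x = 2 * D"
      using dprod[of x] x by (simp add: D_def)
    have "W x * (1 + x) * (poly (pderiv ?Q) x)\<^sup>2 = 2 / (1 - x) + 2 / (1 + x)"
      using weight_identity[unfolded deg, OF W x] unfolding roots
      by (simp add: pderiv_pCons Q1 Qm1 Wm1 power_mult_distrib add.commute flip: power_mult)
    moreover have "W x * (2 * D)\<^sup>2 = (1 + x) * (W x * (1 + x) * (poly (pderiv ?Q) x)\<^sup>2)"
      unfolding dQ [symmetric] by (simp add: power2_eq_square)
    ultimately have "W x * (2 * D)\<^sup>2 = (1 + x) * (2 / (1 - x) + 2 / (1 + x))"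
      by (simp only:)
    moreover have "(1 - x) * (2 / (1 - x)) = 2" "(1 + x) * (2 / (1 + x)) = 2"
      using ne by (metis nonzero_mult_div_cancel_left times_divide_eq_right)+
    ultimately have "W x * ((1 - x) * D\<^sup>2) = 1"
      by algebra
    then show ?thesis
      unfolding D_def by (metis eq_divide_eq mult_zero_right zero_neq_one)
  qed
  show thesis
  proof (rule that)
    show "poly_integral p = W (-1) * poly p (-1) + (\<Sum>x | poly ?Q x = 0. W x * poly p x)"
      if "degree p \<le> 2 * n" for p
      using W[of p] that unfolding roots by simp
    have "(\<Sum>x | poly ?Q x = 0. W x * f x) = 
        (\<Sum>x | poly ?Q x = 0. 1 / ((1 - x) * (poly (pderiv (legendre n)) x)\<^sup>2) * f x)" for f
      by (intro sum.cong) (simp_all add: weight)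
    then show "radau_l (Suc n) f = W (-1) * f (-1) + (\<Sum>x | poly ?Q x = 0. W x * f x)" for f
      unfolding radau_l_def by (simp add: Wm1 add.commute)
  qed
qed

lemma radau_r_exact:
  assumes "n \<ge> 1"
  obtains W where
    "\<And>p. degree p \<le> 2 * n \<Longrightarrow> poly_integral p =
      W 1 * poly p 1 + (\<Sum>x\<in>uminus ` {x. poly (radau_poly (Suc n)) x = 0}. W x * poly p x)"
    "\<And>f. radau_r (Suc n) f =
      W 1 * f 1 + (\<Sum>x\<in>uminus ` {x. poly (radau_poly (Suc n)) x = 0}. W x * f x)"
proof -
  let ?R = "{x. poly (radau_poly (Suc n)) x = 0}"
  obtain W where W:
    "\<And>p. degree p \<le> 2 * n \<Longrightarrow> poly_integral p = W (-1) * poly p (-1) + (\<Sum>x\<in>?R. W x * poly p x)"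
    "\<And>f. radau_l (Suc n) f = W (-1) * f (-1) + (\<Sum>x\<in>?R. W x * f x)"
    using radau_exact[OF assms] by blast
  have reflect: "(\<Sum>x\<in>?R. W x * f (- x)) = (\<Sum>x\<in>uminus ` ?R. W (- x) * f x)" for f
    by (subst sum.reindex) (simp_all add: inj_on_def)
  show thesis
  proof (rule that[of "\<lambda>x. W (- x)"])
    show "radau_r (Suc n) f = W (- 1) * f 1 + (\<Sum>x\<in>uminus ` ?R. W (- x) * f x)" for f
      unfolding radau_r_def W(2) reflect by simp
    show "poly_integral p = W (- 1) * poly p 1 + (\<Sum>x\<in>uminus ` ?R. W (- x) * poly p x)"
      if "degree p \<le> 2 * n" for p
      using W(1)[of "pcompose p [:0, -1:]"] that
      by (simp add: poly_integral_pcompose_uminus poly_pcompose degree_pcompose reflect[symmetric])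
  qed
qed

section \<open>Extremality of the classical rules\<close>

lemma quadrature_bounds_odd:
  assumes n: "n \<ge> 1"
    and \<xi>: "\<And>i. i \<in> {1..N} \<Longrightarrow> \<xi> i \<in> {-1..1}" and w: "\<And>i. i \<in> {1..N} \<Longrightarrow> w i \<ge> 0"
    and T: "exact_on_Pi (quad N w \<xi>) (2 * n - 1)"
    and f: "m_convex_on (2 * n - 1) {-1..1} f"
  shows "gauss n f \<le> quad N w \<xi> f" "quad N w \<xi> f \<le> lobatto (n + 1) f"
proof -
  have deg: "degree p < 2 * n" if "degree p \<le> 2 * n - 1" for p :: "real poly"
    using that n by simp
  show "gauss n f \<le> quad N w \<xi> f"
  proof -
    interpret gauss_type 1 "legendre n" by (rule gauss_type_legendre)
    obtain W where W:
      "\<And>p. degree p < 2 * n \<Longrightarrow> poly_integral p = (\<Sum>x | poly (legendre n) x = 0. W x * poly p x)"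
      "\<And>f. gauss n f = (\<Sum>x | poly (legendre n) x = 0. W x * f x)"
      using gauss_exact[of n] by blast
    show ?thesis
      using quadrature_comparison[OF finite_roots(1) roots_inside, of "{}" "2 * n - 1" W W N w \<xi> f 1]
        card_roots n \<xi> w T f W deg by (simp add: degree_legendre)
  qed
  show "quad N w \<xi> f \<le> lobatto (n + 1) f"
  proof -
    interpret gauss_type "[:1, 0, -1:]" "pderiv (legendre n)"
      by (rule gauss_type_pderiv_legendre) (rule n)
    obtain W where W:
      "\<And>p. degree p < 2 * n \<Longrightarrow> poly_integral p =
        (\<Sum>x\<in>{-1, 1}. W x * poly p x) + (\<Sum>x | poly (pderiv (legendre n)) x = 0. W x * poly p x)"
      "\<And>f. lobatto (n + 1) f =
        (\<Sum>x\<in>{-1, 1}. W x * f x) + (\<Sum>x | poly (pderiv (legendre n)) x = 0. W x * f x)"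
      using lobatto_exact[OF n] by blast
    have sign: "0 \<le> -1 * (\<Prod>e\<in>{-1, 1}. x - e)" if "x \<in> {-1..1}" for x :: real
      using that mult_nonneg_nonpos[of "x + 1" "x - 1"] by simp
    have "-1 * ((\<Sum>x\<in>{-1, 1}. W x * f x) + (\<Sum>x | poly (pderiv (legendre n)) x = 0. W x * f x)) 
      \<le> -1 * quad N w \<xi> f"
    proof (rule quadrature_comparison[OF finite_roots(1) roots_inside _ _ _ T \<xi> w f sign])
      show "card {-1, 1::real} + 2 * card {x. poly (pderiv (legendre n)) x = 0} = 2 * n - 1 + 1"
        using n by (simp add: card_roots degree_pderiv degree_legendre)
    qed (use W(1) deg in auto)
    then show ?thesis unfolding W(2) by simp
  qed
qed

lemma quadrature_bounds_even:
  assumes n: "n \<ge> 1"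
    and \<xi>: "\<And>i. i \<in> {1..N} \<Longrightarrow> \<xi> i \<in> {-1..1}" and w: "\<And>i. i \<in> {1..N} \<Longrightarrow> w i \<ge> 0"
    and T: "exact_on_Pi (quad N w \<xi>) (2 * n)"
    and f: "m_convex_on (2 * n) {-1..1} f"
  shows "radau_l (n + 1) f \<le> quad N w \<xi> f" "quad N w \<xi> f \<le> radau_r (n + 1) f"
proof -
  interpret gauss_type "[:1, 1:]" "radau_poly (Suc n)" by (rule gauss_type_radau_poly)
  let ?R = "{x. poly (radau_poly (Suc n)) x = 0}"
  show "radau_l (n + 1) f \<le> quad N w \<xi> f"
  proof -
    obtain W where W:
      "\<And>p. degree p \<le> 2 * n \<Longrightarrow> poly_integral p = W (-1) * poly p (-1) + (\<Sum>x\<in>?R. W x * poly p x)"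
      "\<And>f. radau_l (Suc n) f = W (-1) * f (-1) + (\<Sum>x\<in>?R. W x * f x)"
      using radau_exact[OF n] by blast
    have "1 * ((\<Sum>x\<in>{-1}. W x * f x) + (\<Sum>x\<in>?R. W x * f x)) \<le> 1 * quad N w \<xi> f"
      by (rule quadrature_comparison[OF finite_roots(1) roots_inside _ _ _ T \<xi> w f])
         (auto simp: card_roots degree_radau_poly W(1))
    then show ?thesis using W(2) by simp
  qed
  show "quad N w \<xi> f \<le> radau_r (n + 1) f"
  proof -
    obtain W where W:
      "\<And>p. degree p \<le> 2 * n \<Longrightarrow> poly_integral p = W 1 * poly p 1 + (\<Sum>x\<in>uminus ` ?R. W x * poly p x)"
      "\<And>f. radau_r (Suc n) f = W 1 * f 1 + (\<Sum>x\<in>uminus ` ?R. W x * f x)"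
      using radau_r_exact[OF n] by blast
    have inside: "uminus ` ?R \<subseteq> {-1<..<1}" using roots_inside by auto
    have "-1 * ((\<Sum>x\<in>{1}. W x * f x) + (\<Sum>x\<in>uminus ` ?R. W x * f x)) \<le> -1 * quad N w \<xi> f"
    proof (rule quadrature_comparison[OF _ inside _ _ _ T \<xi> w f])
      show "card {1::real} + 2 * card (uminus ` ?R) = 2 * n + 1"
        by (simp add: card_image card_roots degree_radau_poly)
      show "poly_integral p = (\<Sum>x\<in>{1}. W x * poly p x) + (\<Sum>x\<in>uminus ` ?R. W x * poly p x)"
        if "degree p \<le> 2 * n" for p
        using W(1)[OF that] by simp
    qed (use finite_roots(1) in auto)
    then show ?thesis using W(2) by simp
  qed
qed

theorem corollary17:
  fixes n N :: nat and \<xi> w :: "nat \<Rightarrow> real"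
  assumes "n \<ge> 1" and "N \<ge> 1"
    and "\<And>i. i \<in> {1..N} \<Longrightarrow> \<xi> i \<in> {-1..1}"
    and "\<And>i. i \<in> {1..N} \<Longrightarrow> w i \<ge> 0"
  shows "(exact_on_Pi (quad N w \<xi>) (2 * n - 1) \<longrightarrow>
            (\<forall>f :: real \<Rightarrow> real. m_convex_on (2 * n - 1) {-1..1} f \<longrightarrow>
               gauss n f \<le> quad N w \<xi> f \<and> quad N w \<xi> f \<le> lobatto (n + 1) f)) \<and>
         (exact_on_Pi (quad N w \<xi>) (2 * n) \<longrightarrow>
            (\<forall>f :: real \<Rightarrow> real. m_convex_on (2 * n) {-1..1} f \<longrightarrow>
               radau_l (n + 1) f \<le> quad N w \<xi> f \<and> quad N w \<xi> f \<le> radau_r (n + 1) f))"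
  by (intro conjI impI allI quadrature_bounds_odd quadrature_bounds_even assms)

end
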